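(* Let $(\mathfrak{g},[~,~]_\mathfrak{g},\alpha)$ and $(\mathfrak{h},[~,~]_\mathfrak{h},\beta)$ be two (multiplicative) Hom-Lie algebras. The degree $0$ bilinear map $$\rho:C^{\bullet+1}_{\mathrm{Hom}}(\mathfrak{g},\mathfrak{g})\times C^\bullet_{\mathrm{Hom}}(\mathfrak{g},\mathfrak{h})\to C^\bullet_{\mathrm{Hom}}(\mathfrak{g},\mathfrak{h}),\qquad \rho(P)(E):=i_PE,$$ for $P\in C^{m+1}_{\mathrm{Hom}}(\mathfrak{g},\mathfrak{g})$ and $E\in C^k_{\mathrm{Hom}}(\mathfrak{g},\mathfrak{h})$, defines an action of the graded Lie algebra $(C^{\bullet+1}_{\mathrm{Hom}}(\mathfrak{g},\mathfrak{g}),[~,~]_{\mathsf{NR}})$ on the graded Lie algebra $(C^\bullet_{\mathrm{Hom}}(\mathfrak{g},\mathfrak{h}),[~,~]_{\mathsf{C}})$.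
   Context: All vector spaces and (multi)linear maps are over a field $\mathbf{k}$ of characteristic $0$. A (multiplicative) Hom-Lie algebra $(\mathfrak{g},[~,~],\alpha)$ is a vector space $\mathfrak{g}$ with a skew-symmetric bilinear map $[~,~]$ and a linear map $\alpha:\mathfrak{g}\to\mathfrak{g}$ such that $[\alpha(x),[y,z]]+[\alpha(y),[z,x]]+[\alpha(z),[x,y]]=0$ and $\alpha([x,y])=[\alpha(x),\alpha(y)]$. For $n\ge 1$, $C^n_{\mathrm{Hom}}(\mathfrak{g},\mathfrak{h})=\{f:\wedge^n\mathfrak{g}\to\mathfrak{h}\mid \beta\circ f=f\circ\alpha^{\wedge n}\}$, and similarly $C^n_{\mathrm{Hom}}(\mathfrak{g},\mathfrak{g})$ (with $\beta$ replaced by $\alpha$). $Sh(m,n)$ is the set of $(m,n)$-shuffles. For $P\in C^m_{\mathrm{Hom}}(\mathfrak{g},\mathfrak{g})$ and $Q\in C^n_{\mathrm{Hom}}(\mathfrak{g},V)$ with $V=\mathfrak{g}$ or $\mathfrak{h}$, the contraction $i_PQ\in C^{m+n-1}_{\mathrm{Hom}}(\mathfrak{g},V)$ is $$(i_PQ)(x_1,\ldots,x_{m+n-1})=\sum_{\sigma\in Sh(m,n-1)}(-1)^\sigma Q\big(P(x_{\sigma(1)},\ldots,x_{\sigma(m)}),\alpha^{m-1}x_{\sigma(m+1)},\ldots,\alpha^{m-1}x_{\sigma(m+n-1)}\big).$$ The Nijenhuis-Richardson bracket of $P\in C^m_{\mathrm{Hom}}(\mathfrak{g},\mathfrak{g})$,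 $Q\in C^n_{\mathrm{Hom}}(\mathfrak{g},\mathfrak{g})$ is $[P,Q]_{\mathsf{NR}}=i_PQ-(-1)^{(m-1)(n-1)}i_QP$; it makes $C^{\bullet+1}_{\mathrm{Hom}}(\mathfrak{g},\mathfrak{g})$ (where $C^{m+1}_{\mathrm{Hom}}(\mathfrak{g},\mathfrak{g})$ is placed in degree $m\ge0$) a graded Lie algebra. On $C^\bullet_{\mathrm{Hom}}(\mathfrak{g},\mathfrak{h})=\bigoplus_{n\ge1}C^n_{\mathrm{Hom}}(\mathfrak{g},\mathfrak{h})$ (with $C^n$ in degree $n$) the cup product bracket $$[P,Q]_{\mathsf{C}}(x_1,\ldots,x_{m+n})=\sum_{\sigma\in Sh(m,n)}(-1)^\sigma[\beta^{n-1}P(x_{\sigma(1)},\ldots,x_{\sigma(m)}),\beta^{m-1}Q(x_{\sigma(m+1)},\ldots,x_{\sigma(m+n)})]_\mathfrak{h}$$ (for $P\in C^m_{\mathrm{Hom}}(\mathfrak{g},\mathfrak{h})$, $Q\in C^n_{\mathrm{Hom}}(\mathfrak{g},\mathfrak{h})$) is a graded Lie bracket. An action of a graded Lie algebra $(\mathcal{A},[~,~]_\mathcal{A})$ on a graded Lie algebra $(\mathcal{B},[~,~]_\mathcal{B})$ is a degree $0$ bilinear map $\rho:\mathcal{A}\times\mathcal{B}\to\mathcal{B}$ such that for homogeneous elements $\rho([a,a']_\mathcal{A})(b)=\rho(a)\rho(a')(b)-(-1)^{|a||a'|}\rho(a')\rho(a)(b)$ and $\rho(a)([b,b']_\mathcal{B})=[\rho(a)b,b']_\mathcal{B}+(-1)^{|a||b|}[b,\rho(a)b']_\mathcal{B}$.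 *)

theory Defs
  imports
    Complex_Main
    "HOL-Library.Function_Algebras"
    "HOL-Combinatorics.Permutations"
begin

section \<open>Graded Lie algebras and their actions\<close>

definition bilinear_on ::
  "('k \<Rightarrow> 'a \<Rightarrow> 'a) \<Rightarrow> 'a set \<Rightarrow> ('k \<Rightarrow> 'b \<Rightarrow> 'b) \<Rightarrow> 'b set \<Rightarrow> ('k \<Rightarrow> 'c \<Rightarrow> 'c) \<Rightarrow> 'c set
    \<Rightarrow> ('a::ab_group_add \<Rightarrow> 'b::ab_group_add \<Rightarrow> 'c::ab_group_add) \<Rightarrow> bool" where
  "bilinear_on sU U sV V sW W f \<longleftrightarrow>
     (\<forall>x\<in>U. \<forall>y\<in>V. f x y \<in> W) \<and>
     (\<forall>x\<in>U. \<forall>x'\<in>U. \<forall>y\<in>V. f (x + x') y = f x y + f x' y) \<and>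
     (\<forall>x\<in>U. \<forall>y\<in>V. \<forall>y'\<in>V. f x (y + y') = f x y + f x y') \<and>
     (\<forall>c. \<forall>x\<in>U. \<forall>y\<in>V. f (sU c x) y = sW c (f x y)) \<and>
     (\<forall>c. \<forall>x\<in>U. \<forall>y\<in>V. f x (sV c y) = sW c (f x y))"

text \<open>
  A graded vector space is an internal direct sum \<open>total\<close> of subspaces \<open>A i\<close> of an ambient
  vector space. Only gradings by the natural numbers are considered, that is, the homogeneous
  components of negative degree are zero.
\<close>

locale graded_vector_space = vector_space scale
  for scale :: "'k::field_char_0 \<Rightarrow> 'v::ab_group_add \<Rightarrow> 'v" +
  fixes A :: "nat \<Rightarrow> 'v set"
  assumes subspace_component: "subspace (A i)"
    and direct: "\<lbrakk>finite I; \<And>i. i \<in> I \<Longrightarrow> v i \<in> A i; (\<Sum>i\<in>I. v i) = 0; j \<in> I\<rbrakk> \<Longrightarrow> v j = 0"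
begin

definition total :: "'v set" where
  "total = span (\<Union>i. A i)"

end

locale graded_lie_algebra = graded_vector_space scale A
  for scale :: "'k::field_char_0 \<Rightarrow> 'v::ab_group_add \<Rightarrow> 'v" and A :: "nat \<Rightarrow> 'v set" +
  fixes br :: "'v \<Rightarrow> 'v \<Rightarrow> 'v"
  assumes bracket_bilinear: "bilinear_on scale total scale total scale total br"
    and bracket_degree: "\<lbrakk>x \<in> A i; y \<in> A j\<rbrakk> \<Longrightarrow> br x y \<in> A (i + j)"
    and bracket_skew: "\<lbrakk>x \<in> A i; y \<in> A j\<rbrakk> \<Longrightarrow> br x y = - scale ((-1) ^ (i * j)) (br y x)"
    and bracket_jacobi: "\<lbrakk>x \<in> A i; y \<in> A j; z \<in> A l\<rbrakk> \<Longrightarrow>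
      br x (br y z) = br (br x y) z + scale ((-1) ^ (i * j)) (br y (br x z))"

locale graded_lie_action =
  A: graded_lie_algebra scaleA A brA + B: graded_lie_algebra scaleB B brB
  for scaleA :: "'k::field_char_0 \<Rightarrow> 'a::ab_group_add \<Rightarrow> 'a" and A and brA
    and scaleB :: "'k \<Rightarrow> 'b::ab_group_add \<Rightarrow> 'b" and B and brB +
  fixes \<rho> :: "'a \<Rightarrow> 'b \<Rightarrow> 'b"
  assumes action_bilinear: "bilinear_on scaleA A.total scaleB B.total scaleB B.total \<rho>"
    and action_degree: "\<lbrakk>a \<in> A i; b \<in> B j\<rbrakk> \<Longrightarrow> \<rho> a b \<in> B (i + j)"
    and action_bracket: "\<lbrakk>a \<in> A i; a' \<in> A j; b \<in> B l\<rbrakk> \<Longrightarrow>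
      \<rho> (brA a a') b = \<rho> a (\<rho> a' b) - scaleB ((-1) ^ (i * j)) (\<rho> a' (\<rho> a b))"
    and action_derivation: "\<lbrakk>a \<in> A i; b \<in> B j; b' \<in> B l\<rbrakk> \<Longrightarrow>
      \<rho> a (brB b b') = brB (\<rho> a b) b' + scaleB ((-1) ^ (i * j)) (brB b (\<rho> a b'))"

section \<open>Hom-Lie algebras\<close>

locale hom_lie_algebra = vector_space scale
  for scale :: "'k::field_char_0 \<Rightarrow> 'v::ab_group_add \<Rightarrow> 'v" +
  fixes br :: "'v \<Rightarrow> 'v \<Rightarrow> 'v" and \<alpha> :: "'v \<Rightarrow> 'v"
  assumes linear_right: "Vector_Spaces.linear scale scale (\<lambda>y. br x y)"
    and linear_left: "Vector_Spaces.linear scale scale (\<lambda>x. br x y)"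
    and skew: "br x y = - br y x"
    and linear_twist: "Vector_Spaces.linear scale scale \<alpha>"
    and hom_jacobi: "br (\<alpha> x) (br y z) + br (\<alpha> y) (br z x) + br (\<alpha> z) (br x y) = 0"
    and multiplicative: "\<alpha> (br x y) = br (\<alpha> x) (\<alpha> y)"

section \<open>Cochains\<close>

text \<open>
  A linear map on the \<open>n\<close>-th exterior power is an alternating \<open>n\<close>-linear map. Its arguments are
  given as a list of length \<open>n\<close>, and it is extended by \<open>0\<close> to lists of other lengths. All
  cochains therefore live in one function space, on which addition is pointwise.
\<close>

definition fun_scale :: "('k \<Rightarrow> 'v \<Rightarrow> 'v) \<Rightarrow> 'k \<Rightarrow> ('g list \<Rightarrow> 'v) \<Rightarrow> ('g list \<Rightarrow> 'v)" where
  "fun_scale s c f = (\<lambda>xs. s c (f xs))"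

definition alternating_maps ::
  "('k::field \<Rightarrow> 'g::ab_group_add \<Rightarrow> 'g) \<Rightarrow> ('k \<Rightarrow> 'v::ab_group_add \<Rightarrow> 'v) \<Rightarrow> nat \<Rightarrow> ('g list \<Rightarrow> 'v) set"
  where
  "alternating_maps sg sV n = {f.
     (\<forall>xs. length xs \<noteq> n \<longrightarrow> f xs = 0) \<and>
     (\<forall>xs i. length xs = n \<longrightarrow> i < n \<longrightarrow> Vector_Spaces.linear sg sV (\<lambda>x. f (xs[i := x]))) \<and>
     (\<forall>xs i j. length xs = n \<longrightarrow> i < j \<longrightarrow> j < n \<longrightarrow> xs ! i = xs ! j \<longrightarrow> f xs = 0)}"

definition C_Hom ::
  "('k::field \<Rightarrow> 'g::ab_group_add \<Rightarrow> 'g) \<Rightarrow> ('g \<Rightarrow> 'g) \<Rightarrow> ('k \<Rightarrow> 'v::ab_group_add \<Rightarrow> 'v) \<Rightarrow> ('v \<Rightarrow> 'v)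
    \<Rightarrow> nat \<Rightarrow> ('g list \<Rightarrow> 'v) set" where
  "C_Hom sg \<alpha> sV \<beta> n =
     {f \<in> alternating_maps sg sV n. \<forall>xs. length xs = n \<longrightarrow> \<beta> (f xs) = f (map \<alpha> xs)}"

definition Sh :: "nat \<Rightarrow> nat \<Rightarrow> (nat \<Rightarrow> nat) set" where
  "Sh m n = {\<sigma>. \<sigma> permutes {0..<m + n} \<and> strict_mono_on {0..<m} \<sigma> \<and> strict_mono_on {m..<m + n} \<sigma>}"

text \<open>
  In the following three operations on homogeneous cochains, \<open>m\<close> and \<open>n\<close> are the (positive)
  numbers of arguments of \<open>P\<close> and \<open>Q\<close>.
\<close>

definition contraction ::
  "('g \<Rightarrow> 'g) \<Rightarrow> ('k::field \<Rightarrow> 'v::ab_group_add \<Rightarrow> 'v) \<Rightarrow> nat \<Rightarrow> nat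
    \<Rightarrow> ('g list \<Rightarrow> 'g) \<Rightarrow> ('g list \<Rightarrow> 'v) \<Rightarrow> ('g list \<Rightarrow> 'v)" where
  "contraction \<alpha> sV m n P Q = (\<lambda>xs. if length xs = m + n - 1 then
     (\<Sum>\<sigma>\<in>Sh m (n - 1). sV (of_int (sign \<sigma>))
        (Q (P (map (\<lambda>i. xs ! \<sigma> i) [0..<m]) #
            map (\<lambda>i. (\<alpha> ^^ (m - 1)) (xs ! \<sigma> i)) [m..<m + n - 1])))
     else 0)"

definition nr_bracket ::
  "('k::field \<Rightarrow> 'g::ab_group_add \<Rightarrow> 'g) \<Rightarrow> ('g \<Rightarrow> 'g) \<Rightarrow> nat \<Rightarrow> nat
    \<Rightarrow> ('g list \<Rightarrow> 'g) \<Rightarrow> ('g list \<Rightarrow> 'g) \<Rightarrow> ('g list \<Rightarrow> 'g)" where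
  "nr_bracket sg \<alpha> m n P Q =
     contraction \<alpha> sg m n P Q - fun_scale sg ((-1) ^ ((m - 1) * (n - 1))) (contraction \<alpha> sg n m Q P)"

definition cup_bracket ::
  "('k::field \<Rightarrow> 'h::ab_group_add \<Rightarrow> 'h) \<Rightarrow> ('h \<Rightarrow> 'h \<Rightarrow> 'h) \<Rightarrow> ('h \<Rightarrow> 'h) \<Rightarrow> nat \<Rightarrow> nat
    \<Rightarrow> ('g list \<Rightarrow> 'h) \<Rightarrow> ('g list \<Rightarrow> 'h) \<Rightarrow> ('g list \<Rightarrow> 'h)" where
  "cup_bracket sh brh \<beta> m n P Q = (\<lambda>xs. if length xs = m + n then
     (\<Sum>\<sigma>\<in>Sh m n. sh (of_int (sign \<sigma>))
        (brh ((\<beta> ^^ (n - 1)) (P (map (\<lambda>i. xs ! \<sigma> i) [0..<m])))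
             ((\<beta> ^^ (m - 1)) (Q (map (\<lambda>i. xs ! \<sigma> i) [m..<m + n])))))
     else 0)"

section \<open>The graded spaces of cochains\<close>

definition arity_part :: "nat \<Rightarrow> ('g list \<Rightarrow> 'v::zero) \<Rightarrow> ('g list \<Rightarrow> 'v)" where
  "arity_part n f = (\<lambda>xs. if length xs = n then f xs else 0)"

text \<open>
  The bilinear extension to direct sums of an operation \<open>F m n\<close> given on homogeneous cochains with
  \<open>m\<close> and \<open>n\<close> arguments. The index sets are finite on the direct sum.
\<close>

definition bilinear_extension ::
  "(nat \<Rightarrow> nat \<Rightarrow> ('g list \<Rightarrow> 'u::ab_group_add) \<Rightarrow> ('g list \<Rightarrow> 'v::ab_group_add) \<Rightarrow> ('g list \<Rightarrow> 'w::ab_group_add))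
    \<Rightarrow> ('g list \<Rightarrow> 'u) \<Rightarrow> ('g list \<Rightarrow> 'v) \<Rightarrow> ('g list \<Rightarrow> 'w)" where
  "bilinear_extension F P Q =
     (\<Sum>m\<in>{m. arity_part m P \<noteq> 0}. \<Sum>n\<in>{n. arity_part n Q \<noteq> 0}. F m n (arity_part m P) (arity_part n Q))"

lemma bilinear_extension_homogeneous:
  assumes P: "\<And>xs. length xs \<noteq> m \<Longrightarrow> P xs = 0" and Q: "\<And>xs. length xs \<noteq> n \<Longrightarrow> Q xs = 0"
    and "F m n 0 Q = 0" and "F m n P 0 = 0"
  shows "bilinear_extension F P Q = F m n P Q"
proof -
  have a: "arity_part k P = (if k = m then P else 0)" for k
    using P by (auto simp: arity_part_def fun_eq_iff)
  have b: "arity_part k Q = (if k = n then Q else 0)" for k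
    using Q by (auto simp: arity_part_def fun_eq_iff)
  have "{k. arity_part k P \<noteq> 0} = (if P = 0 then {} else {m})"
    and "{k. arity_part k Q \<noteq> 0} = (if Q = 0 then {} else {n})"
    by (auto simp: a b)
  then show ?thesis
    using assms(3,4) by (auto simp: bilinear_extension_def a b)
qed

text \<open>In \<open>C_shifted\<close> the cochains with \<open>m + 1\<close> arguments have degree \<open>m\<close>.\<close>

definition C_shifted ::
  "('k::field \<Rightarrow> 'g::ab_group_add \<Rightarrow> 'g) \<Rightarrow> ('g \<Rightarrow> 'g) \<Rightarrow> nat \<Rightarrow> ('g list \<Rightarrow> 'g) set" where
  "C_shifted sg \<alpha> m = C_Hom sg \<alpha> sg \<alpha> (m + 1)"

text \<open>There are no cochains without arguments, so the degree \<open>0\<close> part is zero.\<close>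

definition C_unshifted ::
  "('k::field \<Rightarrow> 'g::ab_group_add \<Rightarrow> 'g) \<Rightarrow> ('g \<Rightarrow> 'g) \<Rightarrow> ('k \<Rightarrow> 'h::ab_group_add \<Rightarrow> 'h) \<Rightarrow> ('h \<Rightarrow> 'h)
    \<Rightarrow> nat \<Rightarrow> ('g list \<Rightarrow> 'h) set" where
  "C_unshifted sg \<alpha> sh \<beta> n = (if n = 0 then {0} else C_Hom sg \<alpha> sh \<beta> n)"

end

theory Submission
  imports Defs
begin

text \<open>
  Contraction and cup product are both convolution products for the unshuffle coproduct: one
  distributes the arguments, in order and with the sign of the resulting permutation, to two parts,
  and feeds the parts to the two cochains. The identities to be proved come from the graded
  coassociativity and graded cocommutativity of this coproduct. It is therefore expressed by a
  recursively defined signed sum \<open>unshuffle_sum\<close> over the splittings of a list, for which these two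
  properties (\<open>unshuffle_sum_coassoc\<close>, \<open>unshuffle_sum_cocomm\<close>) are short inductions. The sums over
  shuffles in the definitions are identified with it once and for all in
  \<open>sum_Sh_eq_unshuffle_sum\<close>.

  In \<open>i\<^sub>P (i\<^sub>Q E)\<close> and in the contraction of \<open>P\<close> into a cup product of \<open>E\<close> and \<open>F\<close>, the value of \<open>P\<close>
  is the first entry of a list that is split again, and so goes to one part or to the other. For
  \<open>i\<^sub>P (i\<^sub>Q E)\<close> this means that \<open>P\<close> is nested in \<open>Q\<close> or that both occupy different slots of \<open>E\<close>. The
  latter terms are graded symmetric in \<open>P\<close> and \<open>Q\<close> and cancel in the graded commutator, which leaves the
  contraction along the Nijenhuis--Richardson bracket (\<open>insertion_commutator\<close>). For the cup product
  the value of \<open>P\<close> enters \<open>E\<close> or \<open>F\<close>, which is the Leibniz rule (\<open>insertion_cup\<close>). The powers of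
  the twist maps match because cochains commute with the twists and brackets are multiplicative.

  That the two brackets are graded Lie brackets is proved on the way. For the
  Nijenhuis--Richardson bracket the Jacobi identity is a formal consequence of the commutator
  formula (\<open>nr_jacobi\<close>). For the cup product bracket it is the Hom-Jacobi identity in each
  summand of a sum over threefold splittings (\<open>cup_jacobi\<close>). Finally all operations
  are extended bilinearly from homogeneous cochains to direct sums.
\<close>

section \<open>Signed sums over the ways to split a list\<close>

text \<open>
  Signs are kept as an operation on an abelian group, so that the combinatorics of splittings
  needs no scalars.
\<close>

definition signed :: "nat \<Rightarrow> 'v \<Rightarrow> 'v::ab_group_add" where
  "signed n v = (if even n then v else - v)"

lemma signed_0 [simp]: "signed 0 v = v"
  and signed_Suc [simp]: "signed (Suc n) v = - signed n v"
  and signed_zero [simp]: "signed n 0 = 0"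
  and signed_signed [simp]: "signed m (signed n v) = signed (m + n) v"
  and signed_uminus [simp]: "signed n (- v) = - signed n v"
  and signed_add: "signed n (v + w) = signed n v + signed n w"
  by (auto simp: signed_def)

lemma signed_cong_parity: "even m = even n \<Longrightarrow> signed m v = signed n v"
  by (simp add: signed_def)

text \<open>
  The value of \<open>G\<close> on the unshuffle coproduct of the tensor word \<open>xs\<close>: the sum over all ways
  to distribute the entries of \<open>xs\<close>, in order, to two lists \<open>ys\<close> and \<open>zs\<close>. The sign is that of
  the permutation that takes \<open>xs\<close> to \<open>ys @ zs\<close>; moving \<open>x\<close> behind \<open>ys\<close> costs \<open>length ys\<close>
  transpositions. All lengths of \<open>ys\<close> are admitted, because cochains vanish on lists of the wrong
  length and so select the length by themselves.
\<close>

fun unshuffle_sum :: "('a list \<Rightarrow> 'a list \<Rightarrow> 'v::ab_group_add) \<Rightarrow> 'a list \<Rightarrow> 'v" where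
  "unshuffle_sum G [] = G [] []"
| "unshuffle_sum G (x # xs) = unshuffle_sum (\<lambda>ys zs. G (x # ys) zs) xs
     + unshuffle_sum (\<lambda>ys zs. signed (length ys) (G ys (x # zs))) xs"

lemma unshuffle_sum_cong:
  assumes "\<And>ys zs. length ys + length zs = length xs \<Longrightarrow> G ys zs = H ys zs"
  shows "unshuffle_sum G xs = unshuffle_sum H xs"
  using assms
proof (induction xs arbitrary: G H)
  case (Cons x xs)
  show ?case
    by (auto intro!: arg_cong2[where f = "(+)"] Cons.IH simp: Cons.prems)
qed simp

lemma unshuffle_sum_zero [simp]: "unshuffle_sum (\<lambda>ys zs. 0) xs = 0"
  by (induction xs) auto

lemma unshuffle_sum_eq_0:
  assumes "\<And>ys zs. length ys + length zs = length xs \<Longrightarrow> G ys zs = 0"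
  shows "unshuffle_sum G xs = 0"
  by (rule trans[OF unshuffle_sum_cong unshuffle_sum_zero]) (rule assms)

lemma unshuffle_sum_add:
  "unshuffle_sum (\<lambda>ys zs. G ys zs + H ys zs) xs = unshuffle_sum G xs + unshuffle_sum H xs"
  by (induction xs arbitrary: G H) (auto simp: signed_add algebra_simps)

lemma unshuffle_sum_hom:
  assumes "additive h"
  shows "h (unshuffle_sum G xs) = unshuffle_sum (\<lambda>ys zs. h (G ys zs)) xs"
proof -
  interpret additive h by fact
  have "h (signed n v) = signed n (h v)" for n v
    by (simp add: signed_def minus)
  then show ?thesis
    by (induction xs arbitrary: G) (auto simp: add)
qed

lemma unshuffle_sum_signed:
  "unshuffle_sum (\<lambda>ys zs. signed n (G ys zs)) xs = signed n (unshuffle_sum G xs)"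
  by (rule unshuffle_sum_hom[symmetric]) (simp add: additive_def signed_add)

lemma unshuffle_sum_map:
  "unshuffle_sum G (map f xs) = unshuffle_sum (\<lambda>ys zs. G (map f ys) (map f zs)) xs"
  by (induction xs arbitrary: G) auto

text \<open>
  Both sides run over the ways to distribute the entries to three lists; each inversion between
  two of the three lists is counted once on either side.
\<close>

lemma unshuffle_sum_coassoc:
  "unshuffle_sum (\<lambda>ys ws. unshuffle_sum (\<lambda>zs vs. H ys zs vs) ws) xs =
   unshuffle_sum (\<lambda>ws vs. unshuffle_sum (\<lambda>ys zs. H ys zs vs) ws) xs"
proof (induction xs arbitrary: H)
  case (Cons x xs)
  have "unshuffle_sum (\<lambda>ws vs. signed (length ws) (unshuffle_sum (\<lambda>ys zs. H ys zs (x # vs)) ws)) xs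
    = unshuffle_sum (\<lambda>ws vs. unshuffle_sum
        (\<lambda>ys zs. signed (length ys + length zs) (H ys zs (x # vs))) ws) xs"
    unfolding unshuffle_sum_signed[symmetric]
    by (intro unshuffle_sum_cong) simp
  then show ?case
    by (simp add: unshuffle_sum_add Cons.IH signed_add add.assoc unshuffle_sum_signed[symmetric])
qed simp

text \<open>
  Moving every entry of one part past every entry of the other exchanges the parts and contributes
  one transposition for each pair.
\<close>

lemma unshuffle_sum_cocomm:
  "unshuffle_sum G xs = unshuffle_sum (\<lambda>ys zs. signed (length ys * length zs) (G zs ys)) xs"
proof (induction xs arbitrary: G)
  case (Cons x xs)
  have "unshuffle_sum (\<lambda>ys zs. G (x # ys) zs) xs
     = unshuffle_sum (\<lambda>ys zs. signed (length ys + length ys * Suc (length zs)) (G (x # zs) ys)) xs"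
    by (subst Cons.IH) (auto intro!: unshuffle_sum_cong signed_cong_parity)
  moreover have "unshuffle_sum (\<lambda>ys zs. signed (length ys) (G ys (x # zs))) xs
     = unshuffle_sum (\<lambda>ys zs. signed (Suc (length ys) * length zs) (G zs (x # ys))) xs"
    by (subst Cons.IH) (auto intro!: unshuffle_sum_cong signed_cong_parity)
  ultimately show ?case
    by (simp add: add.commute del: mult_Suc mult_Suc_right)
qed simp

text \<open>
  Threefold splittings with the first two parts exchanged. This form, together with
  coassociativity, accounts for all reorderings of blocks of arguments below.
\<close>

lemma unshuffle_sum_swap12:
  "unshuffle_sum (\<lambda>ys ws. unshuffle_sum (\<lambda>zs vs. H ys zs vs) ws) xs =
   unshuffle_sum (\<lambda>ys ws. unshuffle_sum
     (\<lambda>zs vs. signed (length ys * length zs) (H zs ys vs)) ws) xs"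
  unfolding unshuffle_sum_coassoc
  by (subst unshuffle_sum_cocomm) (rule refl)

text \<open>
  If both copies of \<open>x\<close> fall into the same part, they stay adjacent there and the summand vanishes.
  The two splittings that separate them differ by one transposition, so they cancel.
\<close>

lemma unshuffle_sum_eq_adjacent:
  assumes "\<And>us vs zs. G (us @ x # x # vs) zs = 0" and "\<And>us vs ys. G ys (us @ x # x # vs) = 0"
  shows "unshuffle_sum G (us @ x # x # vs) = 0"
  using assms
proof (induction us arbitrary: G)
  case Nil
  have "G (x # x # ys) zs = 0" "G ys (x # x # zs) = 0" for ys zs
    using Nil(1)[of "[]"] Nil(2)[of _ "[]"] by auto
  then have "G (x # x # ys) = (\<lambda>zs. 0)" for ys
    by blast
  moreover have "unshuffle_sum (\<lambda>ys zs. - signed (length ys) (G (x # ys) (x # zs))) vs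
     = - unshuffle_sum (\<lambda>ys zs. signed (length ys) (G (x # ys) (x # zs))) vs"
    using unshuffle_sum_signed[of 1] by simp
  ultimately show ?case
    using \<open>\<And>zs ys. G ys (x # x # zs) = 0\<close> by simp
next
  case (Cons u us)
  have "G (u # us @ x # x # vs) zs = 0" "G ys (u # us @ x # x # vs) = 0" for us ys zs vs
    using Cons.prems(1)[of "u # us"] Cons.prems(2)[of _ "u # us"] by auto
  then show ?case
    by (simp add: Cons.IH Cons.prems)
qed

lemma linearI_pointwise:
  assumes "vector_space s" "vector_space s'" "\<And>x y. f (x + y) = f x + f y" "\<And>c x. f (s c x) = s' c (f x)"
  shows "Vector_Spaces.linear s s' f"
  using assms by (simp add: Vector_Spaces.linear_iff)

lemma additive_if_linear: "Vector_Spaces.linear s s' f \<Longrightarrow> additive f"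
  by (simp add: Vector_Spaces.linear_iff additive_def)

lemma linear_unshuffle_sum:
  assumes "vector_space s" "vector_space s'" "\<And>ys zs. Vector_Spaces.linear s s' (\<lambda>x. G x ys zs)"
  shows "Vector_Spaces.linear s s' (\<lambda>x. unshuffle_sum (G x) xs)"
proof (rule linearI_pointwise)
  have "additive (s' c)" for c
    using assms(2) by (simp add: additive_def vector_space_def)
  moreover have "G (s c x) = (\<lambda>ys zs. s' c (G x ys zs))" for c x
    using assms(3) by (auto simp: Vector_Spaces.linear_iff fun_eq_iff)
  ultimately show "unshuffle_sum (G (s c x)) xs = s' c (unshuffle_sum (G x) xs)" for c x
    by (simp add: unshuffle_sum_hom)
  have "G (x + y) = (\<lambda>ys zs. G x ys zs + G y ys zs)" for x y
    using assms(3) by (auto simp: Vector_Spaces.linear_iff fun_eq_iff)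
  then show "unshuffle_sum (G (x + y)) xs = unshuffle_sum (G x) xs + unshuffle_sum (G y) xs" for x y
    by (simp add: unshuffle_sum_add)
qed (use assms in auto)

lemma linear_signed:
  assumes "Vector_Spaces.linear s s' f"
  shows "Vector_Spaces.linear s s' (\<lambda>x. signed n (f x))"
proof -
  interpret V: vector_space s' using assms by (simp add: Vector_Spaces.linear_iff)
  show ?thesis
    using assms by (auto simp: Vector_Spaces.linear_iff signed_def)
qed

lemma linear_uminus:
  assumes "Vector_Spaces.linear s s' f"
  shows "Vector_Spaces.linear s s' (\<lambda>x. - f x)"
  using linear_signed[OF assms, of 1] by simp

lemma linear_add:
  assumes "Vector_Spaces.linear s s' f" "Vector_Spaces.linear s s' g"
  shows "Vector_Spaces.linear s s' (\<lambda>x. f x + g x)"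
proof -
  interpret V: vector_space s' using assms by (simp add: Vector_Spaces.linear_iff)
  show ?thesis
  using assms by (auto simp: Vector_Spaces.linear_iff V.scale_right_distrib algebra_simps)
qed

text \<open>
  Every splitting puts a given slot of \<open>xs\<close> into exactly one slot of one of the parts, so each
  summand is linear in it.
\<close>

lemma linear_slot_unshuffle_sum:
  assumes "vector_space s" "vector_space s'"
    and "\<And>us vs zs. Vector_Spaces.linear s s' (\<lambda>x. G (us @ x # vs) zs)"
    and "\<And>us vs ys. Vector_Spaces.linear s s' (\<lambda>x. G ys (us @ x # vs))"
  shows "Vector_Spaces.linear s s' (\<lambda>x. unshuffle_sum G (us @ x # vs))"
  using assms(3,4)
proof (induction us arbitrary: G)
  case Nil
  have "Vector_Spaces.linear s s' (\<lambda>x. G (x # vs) zs)" "Vector_Spaces.linear s s' (\<lambda>x. G ys (x # vs))" for ys zs vs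
    using Nil(1)[of "[]"] Nil(2)[of _ "[]"] by auto
  then show ?case
    by (auto intro!: linear_add linear_unshuffle_sum linear_signed assms)
next
  case (Cons u us)
  have "Vector_Spaces.linear s s' (\<lambda>x. G (u # us @ x # vs) zs)"
       "Vector_Spaces.linear s s' (\<lambda>x. G ys (u # us @ x # vs))" for us ys zs vs
    using Cons.prems(1)[of "u # us"] Cons.prems(2)[of _ "u # us"] by auto
  then show ?case
    by (auto intro!: linear_add Cons.IH linear_uminus linear_signed Cons.prems)
qed

section \<open>Sums over shuffles\<close>

text \<open>
  A shuffle sends the first position \<open>0\<close> of its first block or the first position \<open>m\<close> of the second
  block to \<open>0\<close>. Removing that position leaves a smaller shuffle, which is recovered by
  \<open>lift_perm\<close>; in the second case the cycle \<open>pull_front m\<close> with \<open>m\<close> inversions has to be composed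
  with it. This is the recursion by which \<^const>\<open>unshuffle_sum\<close> is defined.
\<close>

definition lift_perm :: "(nat \<Rightarrow> nat) \<Rightarrow> nat \<Rightarrow> nat" where
  "lift_perm p i = (case i of 0 \<Rightarrow> 0 | Suc j \<Rightarrow> Suc (p j))"

definition pull_front :: "nat \<Rightarrow> nat \<Rightarrow> nat" where
  "pull_front m i = (if i < m then Suc i else if i = m then 0 else i)"

definition push_back :: "nat \<Rightarrow> nat \<Rightarrow> nat" where
  "push_back m i = (if i = 0 then m else if i \<le> m then i - 1 else i)"

lemma lift_perm_0 [simp]: "lift_perm p 0 = 0"
  and lift_perm_Suc [simp]: "lift_perm p (Suc i) = Suc (p i)"
  by (simp_all add: lift_perm_def)

lemma lift_perm_inj: "lift_perm p = lift_perm q \<longleftrightarrow> p = q"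
  by (metis lift_perm_Suc nat.inject ext)

lemma pull_push [simp]: "pull_front m (push_back m i) = i"
  and push_pull [simp]: "push_back m (pull_front m i) = i"
  by (auto simp: pull_front_def push_back_def)

lemma permutes_atLeast0I:
  fixes p :: "nat \<Rightarrow> nat"
  assumes "\<And>i. i \<ge> N \<Longrightarrow> p i = i" "\<And>i. p (q i) = i" "\<And>i. q (p i) = i"
  shows "p permutes {0..<N}"
  unfolding permutes_def using assms by (metis atLeastLessThan_iff not_less zero_le)

lemma lift_perm_permutes:
  assumes "p permutes {0..<N}"
  shows "lift_perm p permutes {0..<Suc N}"
proof (rule permutes_atLeast0I)
  show "lift_perm p i = i" if "i \<ge> Suc N" for i
    using that assms by (auto simp: lift_perm_def permutes_def split: nat.split)
  show "lift_perm p (lift_perm (inv p) i) = i" "lift_perm (inv p) (lift_perm p i) = i" for i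
    using permutes_inverses[OF assms] by (auto simp: lift_perm_def split: nat.split)
qed

lemma pull_front_permutes: "m < N \<Longrightarrow> pull_front m permutes {0..<N}"
  by (rule permutes_atLeast0I[of _ _ "push_back m"]) (auto simp: pull_front_def push_back_def)

lemma push_back_permutes: "m < N \<Longrightarrow> push_back m permutes {0..<N}"
  by (rule permutes_atLeast0I[of _ _ "pull_front m"]) (auto simp: pull_front_def push_back_def)

lemma sign_lift_perm:
  assumes "p permutes {0..<N}"
  shows "sign (lift_perm p) = sign p"
  using assms finite_atLeastLessThan
proof (induction rule: permutes_induct)
  case id
  have "lift_perm id = id"
    by (auto simp: lift_perm_def fun_eq_iff split: nat.split)
  then show ?case by (rule arg_cong)
next
  case (swap a b p)
  have "lift_perm (Transposition.transpose a b \<circ> p) = Transposition.transpose (Suc a) (Suc b) \<circ> lift_perm p"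
    by (auto simp: lift_perm_def fun_eq_iff Transposition.transpose_def split: nat.split)
  moreover have "permutation p" "permutation (lift_perm p)"
    using swap.hyps lift_perm_permutes finite_atLeastLessThan permutation_permutes by metis+
  ultimately have "sign (lift_perm (Transposition.transpose a b \<circ> p))
      = sign (Transposition.transpose (Suc a) (Suc b)) * sign (lift_perm p)"
    "sign (Transposition.transpose a b \<circ> p) = sign (Transposition.transpose a b) * sign p"
    by (metis sign_compose permutation_swap_id)+
  then show ?case
    using swap by (simp only: sign_swap_id) simp
qed

lemma sign_pull_front: "sign (pull_front m) = (-1) ^ m"
proof (induction m)
  case 0
  have "pull_front 0 = id" by (auto simp: pull_front_def fun_eq_iff)
  then show ?case by (simp)
next
  case (Suc m)
  have "pull_front (Suc m) = pull_front m \<circ> Transposition.transpose m (Suc m)"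
    by (auto simp: pull_front_def fun_eq_iff Transposition.transpose_def)
  moreover have "permutation (pull_front m)"
    using pull_front_permutes[of m "Suc m"] permutation_permutes by blast
  ultimately have "sign (pull_front (Suc m)) = sign (pull_front m) * sign (Transposition.transpose m (Suc m))"
    by (metis sign_compose permutation_swap_id)
  then show ?case
    using Suc by (simp add: sign_swap_id)
qed

lemma ex_lift_perm:
  assumes p: "p permutes {0..<Suc N}" and "p 0 = 0"
  obtains q where "q permutes {0..<N}" "p = lift_perm q"
proof
  have inv: "p (inv p i) = i" "inv p (p i) = i" for i
    using permutes_inverses[OF p] by auto
  have pos: "p (Suc i) \<noteq> 0" "inv p (Suc i) \<noteq> 0" for i
    using inv assms(2) by (metis nat.distinct(1))+
  show "p = lift_perm (\<lambda>i. p (Suc i) - 1)"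
    using pos(1) assms(2) by (auto simp: lift_perm_def fun_eq_iff split: nat.split)
  show "(\<lambda>i. p (Suc i) - 1) permutes {0..<N}"
  proof (rule permutes_atLeast0I)
    show "p (Suc i) - 1 = i" if "i \<ge> N" for i
      using permutes_not_in[OF p, of "Suc i"] that by auto
    show "p (Suc (inv p (Suc i) - 1)) - 1 = i" "inv p (Suc (p (Suc i) - 1)) - 1 = i" for i
      using pos[of i] inv by auto
  qed
qed

lemma finite_Sh [simp]: "finite (Sh m n)"
  by (rule finite_subset[OF _ finite_permutations[of "{0..<m + n}"]]) (auto simp: Sh_def)

lemma Sh_0_0: "Sh 0 0 = {id}"
  by (auto simp: Sh_def strict_mono_on_def)

lemma lift_perm_in_Sh: "q \<in> Sh m n \<Longrightarrow> lift_perm q \<in> Sh (Suc m) n"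
  using lift_perm_permutes[of q "m + n"]
  by (auto simp: Sh_def strict_mono_on_def lift_perm_def split: nat.split)

lemma lift_pull_in_Sh:
  assumes "q \<in> Sh m n"
  shows "lift_perm q \<circ> pull_front m \<in> Sh m (Suc n)"
proof -
  have "lift_perm q \<circ> pull_front m permutes {0..<Suc (m + n)}"
    using assms by (intro permutes_compose pull_front_permutes lift_perm_permutes) (auto simp: Sh_def)
  then show ?thesis
    using assms
    by (auto simp: Sh_def strict_mono_on_def lift_perm_def pull_front_def split: nat.split)
qed

text \<open>
  The preimage of \<open>0\<close> must be the least position of its block, because a shuffle is increasing on
  both blocks.
\<close>

lemma Sh_cases:
  assumes "p \<in> Sh m n" "m + n = Suc N"
  obtains (left) m' q where "m = Suc m'" "q \<in> Sh m' n" "p = lift_perm q"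
    | (right) n' q where "n = Suc n'" "q \<in> Sh m n'" "p = lift_perm q \<circ> pull_front m"
proof -
  have p: "p permutes {0..<Suc N}"
    and mono1: "\<And>i j. i < j \<Longrightarrow> j < m \<Longrightarrow> p i < p j"
    and mono2: "\<And>i j. m \<le> i \<Longrightarrow> i < j \<Longrightarrow> j < m + n \<Longrightarrow> p i < p j"
    using assms by (auto simp: Sh_def strict_mono_on_def)
  define k where "k = inv p 0"
  have k: "p k = 0" using permutes_inverses[OF p] by (simp add: k_def)
  then have kN: "k < m + n"
    using permutes_not_in[OF p, of k] assms(2) by (cases "k < m + n") auto
  show thesis
  proof (cases "k < m")
    case True
    then have "k = 0" using mono1[of 0 k] k by auto
    obtain q where q: "q permutes {0..<N}" "p = lift_perm q"
      using ex_lift_perm[OF p] k \<open>k = 0\<close> by metis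
    obtain m' where m': "m = Suc m'" using True by (cases m) auto
    have "q \<in> Sh m' n"
      using q(1) assms(2) m' mono1[of "Suc _" "Suc _"] mono2[of "Suc _" "Suc _"]
      by (auto simp: Sh_def strict_mono_on_def q(2))
    then show thesis using left m' q by blast
  next
    case False
    then have km: "k = m" using mono2[of m k] k kN by (cases "k = m") auto
    obtain n' where n': "n = Suc n'" using kN km by (cases n) auto
    have "p \<circ> push_back m permutes {0..<Suc N}"
      using kN km assms(2) by (intro permutes_compose p push_back_permutes) auto
    moreover have "(p \<circ> push_back m) 0 = 0" using k km by (simp add: push_back_def)
    ultimately obtain q where q: "q permutes {0..<N}" "p \<circ> push_back m = lift_perm q"
      using ex_lift_perm by metis
    have p_eq: "p = lift_perm q \<circ> pull_front m"
      unfolding q(2)[symmetric] by (simp add: fun_eq_iff)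
    have "q i < q j" if "i < j" "j < m" for i j
      using mono1[of i j] that by (simp add: p_eq pull_front_def)
    moreover have "q i < q j" if "m \<le> i" "i < j" "j < m + n'" for i j
      using mono2[of "Suc i" "Suc j"] that n' by (simp add: p_eq pull_front_def)
    ultimately have "q \<in> Sh m n'"
      using q(1) assms(2) n' by (auto simp: Sh_def strict_mono_on_def)
    then show thesis using right n' p_eq by blast
  qed
qed

lemma Sh_decompose:
  assumes "m + n = Suc N"
  shows "Sh m n = (if m = 0 then {} else lift_perm ` Sh (m - 1) n)
     \<union> (if n = 0 then {} else (\<lambda>q. lift_perm q \<circ> pull_front m) ` Sh m (n - 1))"
proof (intro equalityI subsetI)
  fix p assume "p \<in> Sh m n"
  then show "p \<in> (if m = 0 then {} else lift_perm ` Sh (m - 1) n)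
     \<union> (if n = 0 then {} else (\<lambda>q. lift_perm q \<circ> pull_front m) ` Sh m (n - 1))"
    by (cases rule: Sh_cases[OF _ assms]) auto
next
  fix p assume "p \<in> (if m = 0 then {} else lift_perm ` Sh (m - 1) n)
     \<union> (if n = 0 then {} else (\<lambda>q. lift_perm q \<circ> pull_front m) ` Sh m (n - 1))"
  then show "p \<in> Sh m n"
    using lift_perm_in_Sh[of _ "m - 1" n] lift_pull_in_Sh[of _ m "n - 1"] by (auto split: if_splits)
qed

lemma sum_Sh_Suc:
  assumes "m + n = Suc N"
  shows "(\<Sum>p\<in>Sh m n. f p) = (if m = 0 then 0 else \<Sum>q\<in>Sh (m - 1) n. f (lift_perm q))
     + (if n = 0 then 0 else \<Sum>q\<in>Sh m (n - 1). f (lift_perm q \<circ> pull_front m))"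
proof -
  have inj2: "inj_on (\<lambda>q. lift_perm q \<circ> pull_front m) A" for A
  proof (rule inj_onI)
    fix q q' assume "lift_perm q \<circ> pull_front m = lift_perm q' \<circ> pull_front m"
    then have "lift_perm q i = lift_perm q' i" for i
      by (metis comp_apply pull_push)
    then show "q = q'" using lift_perm_inj by blast
  qed
  have inj1: "inj_on lift_perm A" for A
    by (simp add: inj_on_def lift_perm_inj)
  have "lift_perm q \<noteq> lift_perm q' \<circ> pull_front m" if "m \<noteq> 0" for q q'
  proof
    assume "lift_perm q = lift_perm q' \<circ> pull_front m"
    then have "lift_perm q 0 = (lift_perm q' \<circ> pull_front m) 0" by (rule fun_cong)
    then show False using that by (simp add: pull_front_def)
  qed
  then have disj: "lift_perm ` A \<inter> (\<lambda>q. lift_perm q \<circ> pull_front m) ` B = {}" if "m \<noteq> 0" for A B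
    using that by blast
  show ?thesis
    unfolding Sh_decompose[OF assms]
    using assms by (auto simp: sum.union_disjoint disj sum.reindex inj1 inj2)
qed

text \<open>
  The bridge from sums over shuffles to splittings of lists; both sides satisfy the recursion that
  asks where the first entry of \<open>xs\<close> goes.
\<close>

lemma sum_Sh_eq_unshuffle_sum:
  assumes "vector_space s" "length xs = m + n"
  shows "(\<Sum>p\<in>Sh m n. s (of_int (sign p))
            (G (map (\<lambda>i. xs ! p i) [0..<m]) (map (\<lambda>i. xs ! p i) [m..<m + n])))
       = unshuffle_sum (\<lambda>ys zs. if length ys = m then G ys zs else 0) xs"
  using assms(2)
proof (induction xs arbitrary: m n G)
  case Nil
  interpret vector_space s by fact
  show ?case using Nil by (simp add: Sh_0_0)
next
  case (Cons x xs)
  interpret vector_space s by fact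
  let ?f = "\<lambda>p. s (of_int (sign p))
            (G (map (\<lambda>i. (x # xs) ! p i) [0..<m]) (map (\<lambda>i. (x # xs) ! p i) [m..<m + n]))"
  have left: "(if m = 0 then 0 else \<Sum>q\<in>Sh (m - 1) n. ?f (lift_perm q))
     = unshuffle_sum (\<lambda>ys zs. if length (x # ys) = m then G (x # ys) zs else 0) xs"
  proof (cases m)
    case (Suc m')
    have "?f (lift_perm q) = s (of_int (sign q))
        (G (x # map (\<lambda>i. xs ! q i) [0..<m']) (map (\<lambda>i. xs ! q i) [m'..<m' + n]))" if "q \<in> Sh m' n" for q
    proof -
      have 1: "[0..<m] = 0 # map Suc [0..<m']" and 2: "[m..<m + n] = map Suc [m'..<m' + n]"
        unfolding map_Suc_upt by (auto simp: Suc upt_conv_Cons simp del: upt_Suc)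
      show ?thesis
        unfolding 1 2 using that by (simp add: o_def sign_lift_perm[of q "m' + n"] Sh_def)
    qed
    then show ?thesis
      using Cons.IH[of m' n "\<lambda>ys. G (x # ys)"] Cons.prems Suc by simp
  qed simp
  have right: "(if n = 0 then 0 else \<Sum>q\<in>Sh m (n - 1). ?f (lift_perm q \<circ> pull_front m))
     = unshuffle_sum (\<lambda>ys zs. signed (length ys) (if length ys = m then G ys (x # zs) else 0)) xs"
  proof (cases n)
    case 0
    then show ?thesis
      using Cons.prems by (simp add: unshuffle_sum_eq_0)
  next
    case (Suc n')
    have "?f (lift_perm q \<circ> pull_front m) = s (of_int (sign q))
        (signed m (G (map (\<lambda>i. xs ! q i) [0..<m]) (x # map (\<lambda>i. xs ! q i) [m..<m + n'])))"
      if "q \<in> Sh m n'" for q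
    proof -
      have q: "q permutes {0..<m + n'}" using that by (simp add: Sh_def)
      have "sign (lift_perm q \<circ> pull_front m) = sign q * (-1) ^ m"
        using lift_perm_permutes[OF q] pull_front_permutes[of m "Suc m"] sign_lift_perm[OF q]
        by (subst sign_compose) (auto simp: sign_pull_front permutation_permutes)
      then have sgn: "s (of_int (sign (lift_perm q \<circ> pull_front m))) v = s (of_int (sign q)) (signed m v)" for v
        by (simp add: signed_def)
      have 1: "[m..<m + n] = m # map Suc [m..<m + n']"
        unfolding map_Suc_upt by (auto simp: Suc upt_conv_Cons simp del: upt_Suc)
      have 2: "map (\<lambda>i. (x # xs) ! (lift_perm q \<circ> pull_front m) i) [0..<m] = map (\<lambda>i. xs ! q i) [0..<m]"
        by (simp add: pull_front_def)
      have 3: "map (\<lambda>i. (x # xs) ! (lift_perm q \<circ> pull_front m) i) [m..<m + n]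
          = x # map (\<lambda>i. xs ! q i) [m..<m + n']"
        unfolding 1 by (simp add: pull_front_def)
      show ?thesis
        unfolding sgn 2 3 ..
    qed
    moreover have "unshuffle_sum (\<lambda>ys zs. signed (length ys) (if length ys = m then G ys (x # zs) else 0)) xs
      = unshuffle_sum (\<lambda>ys zs. if length ys = m then signed m (G ys (x # zs)) else 0) xs"
      by (rule unshuffle_sum_cong) simp
    ultimately show ?thesis
      using Cons.IH[of m n' "\<lambda>ys zs. signed m (G ys (x # zs))"] Cons.prems Suc by simp
  qed
  show ?case
    using Cons.prems unfolding unshuffle_sum.simps left[symmetric] right[symmetric]
    by (subst sum_Sh_Suc[of m n "length xs"]) auto
qed

section \<open>Cochains\<close>

locale cochains = G: vector_space sg + V: vector_space sV
  for sg :: "'k::field_char_0 \<Rightarrow> 'g::ab_group_add \<Rightarrow> 'g" and sV :: "'k \<Rightarrow> 'v::ab_group_add \<Rightarrow> 'v" +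
  fixes \<alpha> :: "'g \<Rightarrow> 'g" and \<beta> :: "'v \<Rightarrow> 'v"
  assumes linear_\<alpha>: "Vector_Spaces.linear sg sg \<alpha>" and linear_\<beta>: "Vector_Spaces.linear sV sV \<beta>"
begin

abbreviation C :: "nat \<Rightarrow> ('g list \<Rightarrow> 'v) set" where
  "C \<equiv> C_unshifted sg \<alpha> sV \<beta>"

lemma \<beta>_0 [simp]: "\<beta> 0 = 0" and \<beta>_add: "\<beta> (x + y) = \<beta> x + \<beta> y"
  using linear_\<beta> additive.zero[OF additive_if_linear] by (auto simp: Vector_Spaces.linear_iff)

lemma linear_\<alpha>_pow: "Vector_Spaces.linear sg sg (\<alpha> ^^ k)"
  using linear_\<alpha> by (induction k) (auto simp: Vector_Spaces.linear_iff)

lemma linear_\<beta>_pow: "Vector_Spaces.linear sV sV (\<beta> ^^ k)"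
  using linear_\<beta> by (induction k) (auto simp: Vector_Spaces.linear_iff)

lemma linear_const_0: "Vector_Spaces.linear sg sV (\<lambda>x. 0)"
  by (auto intro: linearI_pointwise G.vector_space_axioms V.vector_space_axioms)

text \<open>
  Polarization: expand the value at \<open>x + y\<close> in two adjacent slots.
\<close>

lemma swap_adjacent:
  assumes "\<And>us vs. Vector_Spaces.linear sg sV (\<lambda>x. f (us @ x # vs))"
    and "\<And>us x vs. f (us @ x # x # vs) = 0"
  shows "f (us @ x # y # vs) = - f (us @ y # x # vs)"
proof -
  have add: "f (us @ (x + y) # vs) = f (us @ x # vs) + f (us @ y # vs)" for us x y vs
    using assms(1) by (simp add: Vector_Spaces.linear_iff)
  have "0 = f (us @ (x + y) # (x + y) # vs)"
    by (simp add: assms(2))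
  also have "\<dots> = f (us @ x # (x + y) # vs) + f (us @ y # (x + y) # vs)"
    by (rule add)
  also have "\<dots> = f (us @ x # y # vs) + f (us @ y # x # vs)"
    using add[of "us @ [x]" x y vs] add[of "us @ [y]" x y vs] by (simp add: assms(2))
  finally show ?thesis
    by (simp add: eq_neg_iff_add_eq_0)
qed

lemma eq_entries_if_eq_adjacent:
  assumes "\<And>us vs. Vector_Spaces.linear sg sV (\<lambda>x. f (us @ x # vs))"
    and "\<And>us x vs. f (us @ x # x # vs) = 0"
  shows "f (us @ x # ws @ x # vs) = 0"
proof (induction ws arbitrary: us)
  case (Cons w ws)
  have "f (us @ x # w # ws @ x # vs) = - f ((us @ [w]) @ x # ws @ x # vs)"
    using swap_adjacent[OF assms, of us x w] by simp
  then show ?case by (simp only: Cons append_Cons minus_zero)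
qed (simp add: assms(2))

text \<open>
  Since cochains vanish on lists of the wrong length, multilinearity and alternation can be
  stated without reference to the arity, and it suffices to test adjacent equal arguments.
\<close>

lemma mem_C_iff:
  "f \<in> C n \<longleftrightarrow>
     (\<forall>xs. length xs \<noteq> n \<or> n = 0 \<longrightarrow> f xs = 0) \<and>
     (\<forall>us vs. Vector_Spaces.linear sg sV (\<lambda>x. f (us @ x # vs))) \<and>
     (\<forall>us x vs. f (us @ x # x # vs) = 0) \<and>
     (\<forall>xs. \<beta> (f xs) = f (map \<alpha> xs))" (is "_ \<longleftrightarrow> ?R")
proof (cases "n = 0")
  case True
  then show ?thesis
    by (auto simp: C_unshifted_def fun_eq_iff linear_const_0)
next
  case False
  show ?thesis
  proof
    assume "f \<in> C n"
    then have len: "\<And>xs. length xs \<noteq> n \<Longrightarrow> f xs = 0"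
      and lin: "\<And>xs i. length xs = n \<Longrightarrow> i < n \<Longrightarrow> Vector_Spaces.linear sg sV (\<lambda>x. f (xs[i := x]))"
      and alt: "\<And>xs i j. length xs = n \<Longrightarrow> i < j \<Longrightarrow> j < n \<Longrightarrow> xs ! i = xs ! j \<Longrightarrow> f xs = 0"
      and tw: "\<And>xs. length xs = n \<Longrightarrow> \<beta> (f xs) = f (map \<alpha> xs)"
      using False by (auto simp: C_unshifted_def C_Hom_def alternating_maps_def)
    have "Vector_Spaces.linear sg sV (\<lambda>x. f (us @ x # vs))" for us vs
    proof (cases "length us + Suc (length vs) = n")
      case True
      then show ?thesis
        using lin[of "us @ 0 # vs" "length us"] by simp
    qed (simp add: len linear_const_0)
    moreover have "f (us @ x # x # vs) = 0" for us x vs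
      using alt[of "us @ x # x # vs" "length us" "Suc (length us)"] len[of "us @ x # x # vs"]
      by (cases "length (us @ x # x # vs) = n") (auto simp: nth_append)
    moreover have "\<beta> (f xs) = f (map \<alpha> xs)" for xs
      using tw len[of xs] len[of "map \<alpha> xs"] by (cases "length xs = n") auto
    ultimately show ?R
      using len False by blast
  next
    assume R: ?R
    have "Vector_Spaces.linear sg sV (\<lambda>x. f (xs[i := x]))" if "length xs = n" "i < n" for xs i
      using R that by (simp add: upd_conv_take_nth_drop)
    moreover have "f xs = 0" if "length xs = n" "i < j" "j < n" "xs ! i = xs ! j" for xs i j
    proof -
      have "xs = take i xs @ xs ! i # drop (Suc i) xs"
        using that by (intro id_take_nth_drop) auto
      moreover have "drop (Suc i) xs = take (j - Suc i) (drop (Suc i) xs) @ xs ! j # drop (Suc j) xs"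
        using that id_take_nth_drop[of "j - Suc i" "drop (Suc i) xs"] by simp
      ultimately have "xs = take i xs @ xs ! i # take (j - Suc i) (drop (Suc i) xs) @ xs ! i # drop (Suc j) xs"
        using that(4) by simp
      then show ?thesis
        using eq_entries_if_eq_adjacent[of f] R by metis
    qed
    ultimately show "f \<in> C n"
      using R False by (auto simp: C_unshifted_def C_Hom_def alternating_maps_def)
  qed
qed

lemma C_length: "f \<in> C n \<Longrightarrow> length xs \<noteq> n \<Longrightarrow> f xs = 0"
  and C_arity_pos: "f \<in> C n \<Longrightarrow> n = 0 \<Longrightarrow> f = 0"
  and C_linear: "f \<in> C n \<Longrightarrow> Vector_Spaces.linear sg sV (\<lambda>x. f (us @ x # vs))"
  and C_adjacent: "f \<in> C n \<Longrightarrow> f (us @ x # x # vs) = 0"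
  and C_twist: "f \<in> C n \<Longrightarrow> \<beta> (f xs) = f (map \<alpha> xs)"
  unfolding mem_C_iff fun_eq_iff by auto

lemma C_additive: "f \<in> C n \<Longrightarrow> additive (\<lambda>x. f (x # vs))"
  using additive_if_linear[OF C_linear[of f n "[]"]] by simp

lemma C_0 [simp]: "f \<in> C n \<Longrightarrow> f (0 # vs) = 0"
  using additive.zero[OF C_additive] .

lemma C_swap: "f \<in> C n \<Longrightarrow> f (x # y # vs) = - f (y # x # vs)"
  using swap_adjacent[of f "[]" x y vs] C_linear C_adjacent by auto

lemma C_twist_pow: "f \<in> C n \<Longrightarrow> (\<beta> ^^ k) (f xs) = f (map (\<alpha> ^^ k) xs)"
  by (induction k) (auto simp: C_twist o_def)

lemma C_0_arity: "C 0 = {0}"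
  by (simp add: C_unshifted_def)

sublocale maps: vector_space "fun_scale sV :: 'k \<Rightarrow> ('g list \<Rightarrow> 'v) \<Rightarrow> _"
  by unfold_locales
    (auto simp: fun_scale_def fun_eq_iff V.scale_right_distrib V.scale_left_distrib)

lemma subspace_C: "maps.subspace (C n)"
proof (rule maps.subspaceI)
  show "0 \<in> C n"
    by (simp add: mem_C_iff linear_const_0)
  show "f + g \<in> C n" if "f \<in> C n" "g \<in> C n" for f g
    using that unfolding mem_C_iff by (auto intro!: linear_add simp: \<beta>_add)
  show "fun_scale sV c f \<in> C n" if "f \<in> C n" for c f
  proof -
    have "\<beta> (sV c x) = sV c (\<beta> x)" for x
      using linear_\<beta> by (simp add: Vector_Spaces.linear_iff)
    moreover have "Vector_Spaces.linear sg sV (\<lambda>x. sV c (f (us @ x # vs)))" for us vs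
      using C_linear[OF that, of us vs]
      by (auto simp: Vector_Spaces.linear_iff V.scale_right_distrib mult.commute)
    ultimately show ?thesis
      using that unfolding mem_C_iff fun_scale_def by auto
  qed
qed

end

section \<open>Bilinear extension from homogeneous cochains\<close>

text \<open>
  The direct sum of the spaces \<open>D n\<close>, described by arity components instead of as a span.
\<close>

definition cochain_sums :: "(nat \<Rightarrow> ('g list \<Rightarrow> 'v) set) \<Rightarrow> ('g list \<Rightarrow> 'v::ab_group_add) set" where
  "cochain_sums D = {f. (\<forall>n. arity_part n f \<in> D n) \<and> finite {n. arity_part n f \<noteq> 0}}"

lemma arity_part_add: "arity_part n (f + g) = arity_part n f + arity_part n g"
  for f g :: "'g list \<Rightarrow> 'v::ab_group_add"
  by (simp add: arity_part_def fun_eq_iff)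

lemma arity_part_0 [simp]: "arity_part n 0 = 0"
  by (simp add: arity_part_def fun_eq_iff)

lemma (in vector_space) arity_part_scale:
  "arity_part n (fun_scale scale c f) = fun_scale scale c (arity_part n f)"
  by (simp add: arity_part_def fun_scale_def fun_eq_iff)

lemma sum_fun_apply: "(\<Sum>i\<in>I. f i) x = (\<Sum>i\<in>I. f i x)" for f :: "'i \<Rightarrow> 'a \<Rightarrow> 'b::ab_group_add"
  by (induction I rule: infinite_finite_induct) auto

lemma sum_arity_parts:
  fixes f :: "'g list \<Rightarrow> 'v::ab_group_add"
  assumes "finite {n. arity_part n f \<noteq> 0}"
  shows "(\<Sum>n | arity_part n f \<noteq> 0. arity_part n f) = f"
proof
  fix xs
  have "f xs = 0" if "arity_part (length xs) f = 0"
    using fun_cong[OF that, of xs] by (simp add: arity_part_def)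
  then show "(\<Sum>n | arity_part n f \<noteq> 0. arity_part n f) xs = f xs"
    using assms by (auto simp: sum_fun_apply arity_part_def sum.delta')
qed

lemma bilinear_extension_eq_sum:
  assumes "finite I" "{m. arity_part m P \<noteq> 0} \<subseteq> I" "finite J" "{n. arity_part n Q \<noteq> 0} \<subseteq> J"
    and "\<And>m n. F m n 0 (arity_part n Q) = 0" "\<And>m n. F m n (arity_part m P) 0 = 0"
  shows "bilinear_extension F P Q = (\<Sum>m\<in>I. \<Sum>n\<in>J. F m n (arity_part m P) (arity_part n Q))"
proof -
  have "(\<Sum>n | arity_part n Q \<noteq> 0. F m n (arity_part m P) (arity_part n Q))
      = (\<Sum>n\<in>J. F m n (arity_part m P) (arity_part n Q))" for m
    using assms by (intro sum.mono_neutral_left) auto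
  then show ?thesis
    unfolding bilinear_extension_def
    using assms by (intro sum.mono_neutral_cong_left) auto
qed

lemma bilinear_on_zero:
  assumes "bilinear_on sU U sV V sW W f" "vector_space sU" "vector_space sV" "vector_space sW"
  shows "0 \<in> U \<Longrightarrow> y \<in> V \<Longrightarrow> f 0 y = 0" "x \<in> U \<Longrightarrow> 0 \<in> V \<Longrightarrow> f x 0 = 0"
proof -
  interpret U: vector_space sU by fact
  interpret V: vector_space sV by fact
  interpret W: vector_space sW by fact
  show "f 0 y = 0" if "0 \<in> U" "y \<in> V"
    using assms(1) that unfolding bilinear_on_def by (metis add_cancel_left_left add_0)
  show "f x 0 = 0" if "x \<in> U" "0 \<in> V"
    using assms(1) that unfolding bilinear_on_def by (metis add_cancel_left_left add_0)
qed

lemma bilinear_extension_eq_if_bilinear_on: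
  assumes bil: "bilinear_on sU U sV V sW W (F m n)"
    and "vector_space sU" "vector_space sV" "vector_space sW" "0 \<in> U" "0 \<in> V"
    and "P \<in> U" "Q \<in> V" "\<And>xs. length xs \<noteq> m \<Longrightarrow> P xs = 0" "\<And>xs. length xs \<noteq> n \<Longrightarrow> Q xs = 0"
  shows "bilinear_extension F P Q = F m n P Q"
  using assms bilinear_on_zero[OF bil] by (intro bilinear_extension_homogeneous) auto

text \<open>
  Over a common finite index set that contains the supports of all arguments involved, the
  extension is a double sum of bilinear maps.
\<close>

lemma bilinear_on_bilinear_extension:
  fixes sU :: "'k::field \<Rightarrow> 'u::ab_group_add \<Rightarrow> 'u" and sV :: "'k \<Rightarrow> 'v::ab_group_add \<Rightarrow> 'v"
    and sW :: "'k \<Rightarrow> 'w::ab_group_add \<Rightarrow> 'w"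
    and F :: "nat \<Rightarrow> nat \<Rightarrow> ('g list \<Rightarrow> 'u) \<Rightarrow> ('g list \<Rightarrow> 'v) \<Rightarrow> ('g list \<Rightarrow> 'w)"
  assumes vs: "vector_space sU" "vector_space sV" "vector_space (fun_scale sU :: 'k \<Rightarrow> ('g list \<Rightarrow> 'u) \<Rightarrow> _)"
      "vector_space (fun_scale sV :: 'k \<Rightarrow> ('g list \<Rightarrow> 'v) \<Rightarrow> _)"
      "vector_space (fun_scale sW :: 'k \<Rightarrow> ('g list \<Rightarrow> 'w) \<Rightarrow> _)"
    and D: "\<And>m. 0 \<in> D m" "\<And>n. 0 \<in> E n"
    and bil: "\<And>m n. bilinear_on (fun_scale sU) (D m) (fun_scale sV) (E n) (fun_scale sW) W (F m n)"
    and W: "module.subspace (fun_scale sW) W"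
  shows "bilinear_on (fun_scale sU) (cochain_sums D) (fun_scale sV) (cochain_sums E) (fun_scale sW) W
           (bilinear_extension F)"
proof -
  interpret U: vector_space sU by fact
  interpret V: vector_space sV by fact
  interpret fW: vector_space "fun_scale sW :: 'k \<Rightarrow> ('g list \<Rightarrow> 'w) \<Rightarrow> _" by fact
  interpret fU: vector_space "fun_scale sU :: 'k \<Rightarrow> ('g list \<Rightarrow> 'u) \<Rightarrow> _" by fact
  interpret fV: vector_space "fun_scale sV :: 'k \<Rightarrow> ('g list \<Rightarrow> 'v) \<Rightarrow> _" by fact
  have F0: "F m n 0 y = 0" if "y \<in> E n" for m n y
    using bilinear_on_zero(1)[OF bil vs(3-5) D(1) that] .
  have F0': "F m n x 0 = 0" if "x \<in> D m" for m n x
    using bilinear_on_zero(2)[OF bil vs(3-5) that D(2)] .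
  have eq: "bilinear_extension F P Q = (\<Sum>m\<in>I. \<Sum>n\<in>J. F m n (arity_part m P) (arity_part n Q))"
    if "P \<in> cochain_sums D" "Q \<in> cochain_sums E" "finite I" "{m. arity_part m P \<noteq> 0} \<subseteq> I"
      "finite J" "{n. arity_part n Q \<noteq> 0} \<subseteq> J" for I J P Q
    using that by (intro bilinear_extension_eq_sum F0 F0') (auto simp: cochain_sums_def)
  have add: "F m n (x + x') y = F m n x y + F m n x' y" "F m n x (y + y') = F m n x y + F m n x y'"
    if "x \<in> D m" "x' \<in> D m" "y \<in> E n" "y' \<in> E n" for x x' y y' m n
    using bil[of m n] that unfolding bilinear_on_def by auto
  have scale: "F m n (fun_scale sU c x) y = fun_scale sW c (F m n x y)"
      "F m n x (fun_scale sV c y) = fun_scale sW c (F m n x y)"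
    if "x \<in> D m" "y \<in> E n" for x y m n c
    using bil[of m n] that unfolding bilinear_on_def by auto
  have mem: "F m n x y \<in> W" if "x \<in> D m" "y \<in> E n" for x y m n
    using bil[of m n] that unfolding bilinear_on_def by auto
  let ?s = "\<lambda>f. {m. arity_part m f \<noteq> 0}"
  show ?thesis
    unfolding bilinear_on_def
  proof (intro conjI ballI allI)
    fix P Q assume PQ: "P \<in> cochain_sums D" "Q \<in> cochain_sums E"
    then have fin: "finite (?s P)" "finite (?s Q)" and parts: "arity_part n P \<in> D n" "arity_part n Q \<in> E n" for n
      by (auto simp: cochain_sums_def)
    show "bilinear_extension F P Q \<in> W"
      unfolding bilinear_extension_def
      by (intro fW.subspace_sum[OF W] mem parts)
    {
      fix P' assume P': "P' \<in> cochain_sums D"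
      then have fin': "finite (?s P')" and parts': "arity_part n P' \<in> D n" for n
        by (auto simp: cochain_sums_def)
      have s: "?s (P + P') \<subseteq> ?s P \<union> ?s P'" by (auto simp: arity_part_add)
      note add1 = add(1)[OF parts(1) parts' parts(2) parts(2)]
        and add2 = add(1)[OF parts(1) parts' D(2) D(2)]
      have "bilinear_extension F (P + P') Q = (\<Sum>m\<in>?s P \<union> ?s P'. \<Sum>n\<in>?s Q.
          F m n (arity_part m (P + P')) (arity_part n Q))"
        using fin fin' s parts parts' by (intro bilinear_extension_eq_sum)
          (auto simp: F0 F0' arity_part_add add1 add2 F0'[OF parts(1)] F0'[OF parts'])
      then show "bilinear_extension F (P + P') Q = bilinear_extension F P Q + bilinear_extension F P' Q"
        using eq[of P Q "?s P \<union> ?s P'" "?s Q"] eq[of P' Q "?s P \<union> ?s P'" "?s Q"] PQ P' fin fin'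
        by (simp add: arity_part_add add1 sum.distrib)
    }
    {
      fix Q' assume Q': "Q' \<in> cochain_sums E"
      then have fin': "finite (?s Q')" and parts': "arity_part n Q' \<in> E n" for n
        by (auto simp: cochain_sums_def)
      have s: "?s (Q + Q') \<subseteq> ?s Q \<union> ?s Q'" by (auto simp: arity_part_add)
      note add1 = add(2)[OF parts(1) parts(1) parts(2) parts']
        and add2 = add(2)[OF D(1) D(1) parts(2) parts']
      have "bilinear_extension F P (Q + Q') = (\<Sum>m\<in>?s P. \<Sum>n\<in>?s Q \<union> ?s Q'.
          F m n (arity_part m P) (arity_part n (Q + Q')))"
        using fin fin' s parts parts' by (intro bilinear_extension_eq_sum)
          (auto simp: F0 F0' arity_part_add add1 add2 F0[OF parts(2)] F0[OF parts'])
      then show "bilinear_extension F P (Q + Q') = bilinear_extension F P Q + bilinear_extension F P Q'"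
        using eq[of P Q "?s P" "?s Q \<union> ?s Q'"] eq[of P Q' "?s P" "?s Q \<union> ?s Q'"] PQ Q' fin fin'
        by (simp add: arity_part_add add1 sum.distrib)
    }
    fix c
    \<comment> \<open>The support of a multiple of \<open>P\<close> can be smaller than that of \<open>P\<close>, hence the fixed index set.\<close>
    have "bilinear_extension F (fun_scale sU c P) Q = (\<Sum>m\<in>?s P. \<Sum>n\<in>?s Q.
          F m n (arity_part m (fun_scale sU c P)) (arity_part n Q))"
      using fin parts by (intro bilinear_extension_eq_sum)
        (auto simp: F0 F0' U.arity_part_scale scale(1)[OF parts(1) D(2)] F0'[OF parts(1)])
    then show "bilinear_extension F (fun_scale sU c P) Q = fun_scale sW c (bilinear_extension F P Q)"
      by (simp add: bilinear_extension_def U.arity_part_scale scale[OF parts] fW.scale_sum_right)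
    have "bilinear_extension F P (fun_scale sV c Q) = (\<Sum>m\<in>?s P. \<Sum>n\<in>?s Q.
          F m n (arity_part m P) (arity_part n (fun_scale sV c Q)))"
      using fin parts by (intro bilinear_extension_eq_sum)
        (auto simp: F0 F0' V.arity_part_scale scale(2)[OF D(1) parts(2)] scale(2)[OF parts] F0[OF parts(2)])
    then show "bilinear_extension F P (fun_scale sV c Q) = fun_scale sW c (bilinear_extension F P Q)"
      by (simp add: bilinear_extension_def V.arity_part_scale scale[OF parts] fW.scale_sum_right)
  qed
qed

context cochains
begin

lemma arity_part_C: "f \<in> C n \<Longrightarrow> arity_part m f = (if m = n then f else 0)"
  using C_length[of f n] by (auto simp: arity_part_def fun_eq_iff)

lemma subspace_cochain_sums: "maps.subspace (cochain_sums C)"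
proof (rule maps.subspaceI)
  show "0 \<in> cochain_sums C"
    using maps.subspace_0[OF subspace_C] by (simp add: cochain_sums_def)
  show "f + g \<in> cochain_sums C" if "f \<in> cochain_sums C" "g \<in> cochain_sums C" for f g
  proof -
    have "{n. arity_part n (f + g) \<noteq> 0} \<subseteq> {n. arity_part n f \<noteq> 0} \<union> {n. arity_part n g \<noteq> 0}"
      by (auto simp: arity_part_add)
    then have "finite {n. arity_part n (f + g) \<noteq> 0}"
      by (rule finite_subset) (use that in \<open>auto simp: cochain_sums_def\<close>)
    then show ?thesis
      using that maps.subspace_add[OF subspace_C]
      by (auto simp: cochain_sums_def arity_part_add)
  qed
  show "fun_scale sV c f \<in> cochain_sums C" if "f \<in> cochain_sums C" for c f
  proof -
    have "{n. arity_part n (fun_scale sV c f) \<noteq> 0} \<subseteq> {n. arity_part n f \<noteq> 0}"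
      by (auto simp: V.arity_part_scale)
    then have "finite {n. arity_part n (fun_scale sV c f) \<noteq> 0}"
      by (rule finite_subset) (use that in \<open>auto simp: cochain_sums_def\<close>)
    then show ?thesis
      using that maps.subspace_scale[OF subspace_C]
      by (auto simp: cochain_sums_def V.arity_part_scale)
  qed
qed

lemma C_subset_cochain_sums: "C n \<subseteq> cochain_sums C"
  using maps.subspace_0[OF subspace_C] by (auto simp: cochain_sums_def arity_part_C)

lemma span_C: "maps.span (\<Union>n. C n) = cochain_sums C"
proof
  show "maps.span (\<Union>n. C n) \<subseteq> cochain_sums C"
    using C_subset_cochain_sums by (intro maps.span_minimal subspace_cochain_sums) auto
  show "cochain_sums C \<subseteq> maps.span (\<Union>n. C n)"
  proof
    fix f assume f: "f \<in> cochain_sums C"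
    then have "(\<Sum>n | arity_part n f \<noteq> 0. arity_part n f) \<in> maps.span (\<Union>n. C n)"
      by (intro maps.span_sum maps.span_base) (auto simp: cochain_sums_def)
    then show "f \<in> maps.span (\<Union>n. C n)"
      using sum_arity_parts[of f] f by (auto simp: cochain_sums_def)
  qed
qed

text \<open>
  Dropping the zero space of arity \<open>0\<close> does not change the span, so that the shifted and the
  unshifted grading have the same total space.
\<close>

lemma span_C_Suc: "maps.span (\<Union>n. C (Suc n)) = cochain_sums C"
proof -
  have "(\<Union>n. C n) = insert 0 (\<Union>n. C (Suc n))"
    using maps.subspace_0[OF subspace_C]
    by (auto simp: C_0_arity elim: not0_implies_Suc) (metis C_0_arity not0_implies_Suc singletonD)+
  then show ?thesis
    unfolding span_C[symmetric] by (metis maps.span_insert_0)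
qed

text \<open>
  Components of different arities are supported on lists of different lengths. The index map
  \<open>k\<close> allows for the shifted grading.
\<close>

lemma C_direct:
  assumes "finite I" "inj_on k I" "\<And>i. i \<in> I \<Longrightarrow> v i \<in> C (k i)" "(\<Sum>i\<in>I. v i) = 0" "j \<in> I"
  shows "v j = 0"
proof
  fix xs
  show "v j xs = 0 xs"
  proof (cases "length xs = k j")
    case True
    have "(\<Sum>i\<in>I. v i) xs = (\<Sum>i\<in>I. if i = j then v j xs else 0)"
      unfolding sum_fun_apply
    proof (rule sum.cong)
      fix i assume "i \<in> I"
      then show "v i xs = (if i = j then v j xs else 0)"
        using assms(2,5) True C_length[OF assms(3), of i xs] by (auto simp: inj_on_def)
    qed simp
    then show ?thesis using assms by simp
  qed (use assms C_length in auto)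
qed

lemma graded_C: "graded_vector_space (fun_scale sV) C"
  by unfold_locales (auto intro: subspace_C C_direct[where k = id])

lemma graded_C_Suc: "graded_vector_space (fun_scale sV) (\<lambda>n. C (Suc n))"
  by unfold_locales (auto intro: subspace_C C_direct[where k = Suc])

end

section \<open>Contraction\<close>

text \<open>
  The contraction \<open>i\<^sub>P Q\<close> as a sum over splittings; \<open>p\<close> is the degree of \<open>P\<close>, one less than the
  number of its arguments.
\<close>

definition insertion :: "('g \<Rightarrow> 'g) \<Rightarrow> nat \<Rightarrow> ('g list \<Rightarrow> 'g) \<Rightarrow> ('g list \<Rightarrow> 'v::ab_group_add) \<Rightarrow> 'g list \<Rightarrow> 'v" where
  "insertion \<alpha> p P Q xs = unshuffle_sum (\<lambda>ys zs. Q (P ys # map (\<alpha> ^^ p) zs)) xs"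

locale contractions = GG: cochains sg sg \<alpha> \<alpha> + GV: cochains sg sV \<alpha> \<beta>
  for sg :: "'k::field_char_0 \<Rightarrow> 'g::ab_group_add \<Rightarrow> 'g" and sV :: "'k \<Rightarrow> 'v::ab_group_add \<Rightarrow> 'v"
    and \<alpha> :: "'g \<Rightarrow> 'g" and \<beta> :: "'v \<Rightarrow> 'v"
begin

lemma contraction_eq_insertion:
  assumes P: "P \<in> GG.C m" and Q: "Q \<in> GV.C n"
  shows "contraction \<alpha> sV m n P Q = insertion \<alpha> (m - 1) P Q"
proof (cases "m = 0 \<or> n = 0")
  case True
  then have "P = (\<lambda>_. 0) \<or> Q = (\<lambda>_. 0)"
    using GG.C_arity_pos[OF P] GV.C_arity_pos[OF Q] by (auto simp: fun_eq_iff)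
  then show ?thesis
    using GV.C_0[OF Q] by (auto simp: contraction_def insertion_def fun_eq_iff)
next
  case False
  then obtain n' where n: "n = Suc n'" by (cases n) auto
  show ?thesis
  proof
    fix xs
    let ?G = "\<lambda>ys zs. Q (P ys # map (\<alpha> ^^ (m - 1)) zs)"
    have supp: "?G ys zs = 0" if "length ys \<noteq> m \<or> length zs \<noteq> n'" for ys zs
      using that GG.C_length[OF P, of ys] GV.C_length[OF Q, of "P ys # map (\<alpha> ^^ (m - 1)) zs"] GV.C_0[OF Q] n
      by auto
    show "contraction \<alpha> sV m n P Q xs = insertion \<alpha> (m - 1) P Q xs"
    proof (cases "length xs = m + n'")
      case True
      have "contraction \<alpha> sV m n P Q xs = unshuffle_sum (\<lambda>ys zs. if length ys = m then ?G ys zs else 0) xs"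
        unfolding sum_Sh_eq_unshuffle_sum[OF GV.V.vector_space_axioms True, where G = ?G, symmetric]
        using True by (simp add: contraction_def n o_def)
      also have "\<dots> = unshuffle_sum ?G xs"
        by (rule unshuffle_sum_cong) (use supp in auto)
      finally show ?thesis by (simp add: insertion_def)
    next
      case False
      then show ?thesis
        using supp by (auto simp: contraction_def insertion_def n intro!: unshuffle_sum_eq_0)
    qed
  qed
qed

text \<open>
  Linearity and alternation are inherited from the two factors through the splitting; the twists
  commute with the contraction because they commute with both cochains.
\<close>

lemma insertion_in_C:
  assumes P: "P \<in> GG.C (Suc p)" and Q: "Q \<in> GV.C n"
  shows "insertion \<alpha> p P Q \<in> GV.C (p + n)"
  unfolding GV.mem_C_iff
proof (intro conjI allI impI)
  let ?G = "\<lambda>ys zs. Q (P ys # map (\<alpha> ^^ p) zs)"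
  have supp: "?G ys zs = 0" if "length ys + length zs \<noteq> p + n \<or> n = 0" for ys zs
    using that GG.C_length[OF P, of ys] GV.C_length[OF Q, of "P ys # map (\<alpha> ^^ p) zs"] GV.C_0[OF Q]
      GV.C_arity_pos[OF Q]
    by (cases "length ys = Suc p") auto
  show "insertion \<alpha> p P Q xs = 0" if "length xs \<noteq> p + n \<or> p + n = 0" for xs
    unfolding insertion_def using that by (intro unshuffle_sum_eq_0 supp) auto
  have linQ: "Vector_Spaces.linear sg sV (\<lambda>x. Q (x # zs))" for zs
    using GV.C_linear[OF Q, of "[]"] by simp
  have "Vector_Spaces.linear sg sV (\<lambda>x. ?G (us @ x # vs) zs)" for us vs zs
    using Vector_Spaces.linear_compose[OF GG.C_linear[OF P] linQ] by (simp add: o_def)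
  moreover have "Vector_Spaces.linear sg sV (\<lambda>x. ?G ys (us @ x # vs))" for us vs ys
    using Vector_Spaces.linear_compose[OF GG.linear_\<alpha>_pow[of p]
        GV.C_linear[OF Q, of "P ys # map (\<alpha> ^^ p) us" "map (\<alpha> ^^ p) vs"]] by (simp add: o_def)
  ultimately show "Vector_Spaces.linear sg sV (\<lambda>x. insertion \<alpha> p P Q (us @ x # vs))" for us vs
    unfolding insertion_def
    by (intro linear_slot_unshuffle_sum GG.G.vector_space_axioms GV.V.vector_space_axioms)
  show "insertion \<alpha> p P Q (us @ x # x # vs) = 0" for us x vs
    unfolding insertion_def
    using GG.C_adjacent[OF P] GV.C_0[OF Q] GV.C_adjacent[OF Q, of "P _ # map (\<alpha> ^^ p) _"]
    by (intro unshuffle_sum_eq_adjacent) auto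
  show "\<beta> (insertion \<alpha> p P Q xs) = insertion \<alpha> p P Q (map \<alpha> xs)" for xs
    unfolding insertion_def unshuffle_sum_hom[OF additive_if_linear[OF GV.linear_\<beta>]] unshuffle_sum_map
    by (simp add: GV.C_twist[OF Q] GG.C_twist[OF P] o_def funpow_swap1)
qed

lemma insertion_add_left:
  "Q \<in> GV.C n \<Longrightarrow> insertion \<alpha> p (P + P') Q = insertion \<alpha> p P Q + insertion \<alpha> p P' Q"
  using additive.add[OF GV.C_additive]
  by (simp add: insertion_def fun_eq_iff unshuffle_sum_add[symmetric])

lemma insertion_add_right: "insertion \<alpha> p P (Q + Q') = insertion \<alpha> p P Q + insertion \<alpha> p P Q'"
  by (simp add: insertion_def fun_eq_iff unshuffle_sum_add[symmetric])

lemma insertion_scale_left: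
  assumes "Q \<in> GV.C n"
  shows "insertion \<alpha> p (fun_scale sg c P) Q = fun_scale sV c (insertion \<alpha> p P Q)"
proof -
  have "Q (sg c x # zs) = sV c (Q (x # zs))" for x zs
    using GV.C_linear[OF assms, of "[]" zs] by (simp add: Vector_Spaces.linear_iff)
  moreover have "additive (sV c)"
    by (simp add: additive_def GV.V.scale_right_distrib)
  ultimately show ?thesis
    by (simp add: insertion_def fun_eq_iff fun_scale_def unshuffle_sum_hom)
qed

lemma insertion_scale_right: "insertion \<alpha> p P (fun_scale sV c Q) = fun_scale sV c (insertion \<alpha> p P Q)"
  by (simp add: insertion_def fun_eq_iff fun_scale_def unshuffle_sum_hom additive_def
      GV.V.scale_right_distrib)

lemma insertion_diff_right: "insertion \<alpha> p P (Q - Q') = insertion \<alpha> p P Q - insertion \<alpha> p P Q'"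
  using insertion_add_right[of p P "Q - Q'" Q'] by (simp add: algebra_simps)

lemma insertion_diff_left:
  "Q \<in> GV.C n \<Longrightarrow> insertion \<alpha> p (P - P') Q = insertion \<alpha> p P Q - insertion \<alpha> p P' Q"
  using insertion_add_left[of Q n p "P - P'" P'] by (simp add: algebra_simps)

lemma bilinear_contraction:
  "bilinear_on (fun_scale sg) (GG.C m) (fun_scale sV) (GV.C n) (fun_scale sV) (cochain_sums GV.C)
     (contraction \<alpha> sV m n)"
proof -
  have "contraction \<alpha> sV m n P Q \<in> cochain_sums GV.C" if P: "P \<in> GG.C m" and Q: "Q \<in> GV.C n" for P Q
  proof (cases m)
    case 0
    then have "P = 0" using GG.C_arity_pos P by blast
    then have "contraction \<alpha> sV m n P Q = 0"
      using GV.C_0[OF Q] contraction_eq_insertion[OF P Q] by (simp add: insertion_def fun_eq_iff)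
    then show ?thesis using GV.maps.subspace_0[OF GV.subspace_cochain_sums] by simp
  next
    case (Suc p)
    then show ?thesis
      using insertion_in_C[of P p Q n] GV.C_subset_cochain_sums that by (auto simp: contraction_eq_insertion)
  qed
  then show ?thesis
    unfolding bilinear_on_def
    using GG.maps.subspace_add[OF GG.subspace_C] GG.maps.subspace_scale[OF GG.subspace_C]
      GV.maps.subspace_add[OF GV.subspace_C] GV.maps.subspace_scale[OF GV.subspace_C]
    by (auto simp: contraction_eq_insertion insertion_add_left insertion_add_right insertion_scale_left
        insertion_scale_right)
qed

text \<open>
  The part of \<open>i\<^sub>P (i\<^sub>Q E)\<close> in which \<open>P\<close> and \<open>Q\<close> occupy different slots of \<open>E\<close>.
\<close>

definition double_insertion ::
  "nat \<Rightarrow> nat \<Rightarrow> ('g list \<Rightarrow> 'g) \<Rightarrow> ('g list \<Rightarrow> 'g) \<Rightarrow> ('g list \<Rightarrow> 'v) \<Rightarrow> 'g list \<Rightarrow> 'v" where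
  "double_insertion p q P Q E xs = unshuffle_sum (\<lambda>ys ws. unshuffle_sum (\<lambda>us vs.
     signed (length us) (E ((\<alpha> ^^ p) (Q us) # (\<alpha> ^^ q) (P ys) # map (\<alpha> ^^ (p + q)) vs))) ws) xs"

text \<open>
  In \<open>i\<^sub>P (i\<^sub>Q E)\<close> the value of \<open>P\<close> is the first entry of the list that \<open>i\<^sub>Q E\<close> splits. Hence the
  recursion of \<^const>\<open>unshuffle_sum\<close> says exactly that this value goes either into \<open>Q\<close>, which gives
  \<open>i\<close> of \<open>i\<^sub>P Q\<close> by coassociativity, or directly into \<open>E\<close>.
\<close>

lemma insertion_insertion:
  assumes P: "P \<in> GG.C (Suc p)" and Q: "Q \<in> GG.C (Suc q)" and E: "E \<in> GV.C e"
  shows "insertion \<alpha> p P (insertion \<alpha> q Q E)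
       = insertion \<alpha> (p + q) (insertion \<alpha> p P Q) E + double_insertion p q P Q E"
proof
  fix xs
  have pow: "map (\<alpha> ^^ q) (map (\<alpha> ^^ p) vs) = map (\<alpha> ^^ (p + q)) vs" for vs
    by (simp add: add.commute[of p] funpow_add o_def)
  have "insertion \<alpha> p P (insertion \<alpha> q Q E) xs = unshuffle_sum (\<lambda>ys ws.
      unshuffle_sum (\<lambda>us vs. E (Q (P ys # map (\<alpha> ^^ p) us) # map (\<alpha> ^^ (p + q)) vs)) ws
      + unshuffle_sum (\<lambda>us vs. signed (length us)
          (E ((\<alpha> ^^ p) (Q us) # (\<alpha> ^^ q) (P ys) # map (\<alpha> ^^ (p + q)) vs))) ws) xs"
    unfolding insertion_def unshuffle_sum.simps unshuffle_sum_map list.map pow length_map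
      GG.C_twist_pow[OF Q] ..
  also have "\<dots> = unshuffle_sum (\<lambda>ys ws.
      unshuffle_sum (\<lambda>us vs. E (Q (P ys # map (\<alpha> ^^ p) us) # map (\<alpha> ^^ (p + q)) vs)) ws) xs
      + double_insertion p q P Q E xs"
    unfolding unshuffle_sum_add double_insertion_def ..
  also have "unshuffle_sum (\<lambda>ys ws.
      unshuffle_sum (\<lambda>us vs. E (Q (P ys # map (\<alpha> ^^ p) us) # map (\<alpha> ^^ (p + q)) vs)) ws) xs
      = insertion \<alpha> (p + q) (insertion \<alpha> p P Q) E xs"
    unfolding unshuffle_sum_coassoc insertion_def unshuffle_sum_hom[OF GV.C_additive[OF E]] ..
  finally show "insertion \<alpha> p P (insertion \<alpha> q Q E) xs
       = (insertion \<alpha> (p + q) (insertion \<alpha> p P Q) E + double_insertion p q P Q E) xs"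
    by simp
qed

text \<open>
  Exchanging the blocks of \<open>p + 1\<close> and \<open>q + 1\<close> arguments gives the sign \<open>(p + 1) (q + 1)\<close>, and
  exchanging the two values in the alternating map \<open>E\<close> gives one more. Together with the sign
  \<open>q + 1\<close> on the left and \<open>p + 1\<close> on the right, which are part of the definition, this is
  congruent to \<open>p q\<close> modulo \<open>2\<close>.
\<close>

lemma double_insertion_swap:
  assumes P: "P \<in> GG.C (Suc p)" and Q: "Q \<in> GG.C (Suc q)" and E: "E \<in> GV.C e"
  shows "double_insertion p q P Q E xs = signed (p * q) (double_insertion q p Q P E xs)"
proof -
  have "signed (length ys * length us + length ys)
          (E ((\<alpha> ^^ p) (Q ys) # (\<alpha> ^^ q) (P us) # map (\<alpha> ^^ (p + q)) vs))
      = signed (p * q + length us) (E ((\<alpha> ^^ q) (P us) # (\<alpha> ^^ p) (Q ys) # map (\<alpha> ^^ (p + q)) vs))"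
    for ys us vs
  proof (cases "length ys = Suc q \<and> length us = Suc p")
    case True
    then show ?thesis
      unfolding GV.C_swap[OF E, of "(\<alpha> ^^ p) (Q ys)"] by (auto simp: signed_def)
  next
    case False
    then have "Q ys = 0 \<or> P us = 0"
      using GG.C_length[OF P] GG.C_length[OF Q] by blast
    moreover have "(\<alpha> ^^ k) 0 = 0" for k
      using additive.zero[OF additive_if_linear[OF GG.linear_\<alpha>_pow]] .
    moreover have "E (x # 0 # vs) = 0" "E (0 # x # vs) = 0" for x vs
      using GV.C_0[OF E] GV.C_swap[OF E, of x 0] by auto
    ultimately show ?thesis by auto
  qed
  then show ?thesis
    unfolding double_insertion_def unshuffle_sum_signed[symmetric]
    by (subst unshuffle_sum_swap12) (simp add: add.commute[of q])
qed

text \<open>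
  The disjoint insertions are graded symmetric in \<open>P\<close> and \<open>Q\<close> and cancel; only the nested ones
  survive. This holds for cochains \<open>E\<close> with values in any space with a twist, and serves both for
  the action and for the Jacobi identity of the bracket.
\<close>

lemma insertion_commutator:
  assumes P: "P \<in> GG.C (Suc p)" and Q: "Q \<in> GG.C (Suc q)" and E: "E \<in> GV.C e"
  shows "insertion \<alpha> (p + q) (insertion \<alpha> p P Q - fun_scale sg ((-1) ^ (p * q)) (insertion \<alpha> q Q P)) E
    = insertion \<alpha> p P (insertion \<alpha> q Q E)
      - fun_scale sV ((-1) ^ (p * q)) (insertion \<alpha> q Q (insertion \<alpha> p P E))"
proof -
  have sc: "fun_scale sV ((-1) ^ k) f xs = signed k (f xs)" for k and f :: "'g list \<Rightarrow> 'v" and xs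
    by (simp add: fun_scale_def signed_def)
  show ?thesis
    unfolding insertion_diff_left[OF E] insertion_scale_left[OF E] insertion_insertion[OF P Q E]
      insertion_insertion[OF Q P E]
    by (auto simp: fun_eq_iff sc signed_add double_insertion_swap[OF P Q E] add.commute[of q])
qed

end

section \<open>The Nijenhuis--Richardson bracket\<close>

lemma bilinear_on_diff_flip:
  assumes f: "bilinear_on s U s V s W f" and g: "bilinear_on s V s U s W g"
    and "vector_space s" "module.subspace s W"
  shows "bilinear_on s U s V s W (\<lambda>x y. f x y - s k (g y x))"
proof -
  interpret vector_space s by fact
  show ?thesis
    using f g subspace_diff[OF assms(4)] subspace_scale[OF assms(4)]
    unfolding bilinear_on_def
    by (auto simp: scale_right_distrib scale_right_diff_distrib mult.commute)
qed

locale nr_bracket_algebra = contractions sg sg \<alpha> \<alpha>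
  for sg :: "'k::field_char_0 \<Rightarrow> 'g::ab_group_add \<Rightarrow> 'g" and \<alpha> :: "'g \<Rightarrow> 'g"
begin

abbreviation sign_scale :: "nat \<Rightarrow> ('g list \<Rightarrow> 'g) \<Rightarrow> 'g list \<Rightarrow> 'g" where
  "sign_scale k \<equiv> fun_scale sg ((-1) ^ k)"

definition nr :: "nat \<Rightarrow> nat \<Rightarrow> ('g list \<Rightarrow> 'g) \<Rightarrow> ('g list \<Rightarrow> 'g) \<Rightarrow> 'g list \<Rightarrow> 'g" where
  "nr p q P Q = insertion \<alpha> p P Q - sign_scale (p * q) (insertion \<alpha> q Q P)"

lemma nr_bracket_eq_nr:
  "P \<in> GG.C (Suc p) \<Longrightarrow> Q \<in> GG.C (Suc q) \<Longrightarrow> nr_bracket sg \<alpha> (Suc p) (Suc q) P Q = nr p q P Q"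
  by (simp add: nr_bracket_def nr_def contraction_eq_insertion)

lemma nr_in_C:
  assumes "P \<in> GG.C (Suc p)" "Q \<in> GG.C (Suc q)"
  shows "nr p q P Q \<in> GG.C (Suc (p + q))"
  using insertion_in_C[OF assms] insertion_in_C[OF assms(2,1)] unfolding nr_def
  by (auto intro!: GG.maps.subspace_diff GG.maps.subspace_scale GG.subspace_C simp: add.commute)

lemma nr_skew: "nr p q P Q = - sign_scale (p * q) (nr q p Q P)"
  by (simp add: nr_def GG.maps.scale_right_diff_distrib mult.commute
      flip: power_add)

text \<open>
  Both sides expand into iterated contractions. Those that contain a contraction along a bracket
  are resolved by the commutator formula, and what remains are the six terms obtained by
  contracting one of the cochains twice, with matching signs.
\<close>

lemma nr_jacobi:
  assumes P: "P \<in> GG.C (Suc p)" and Q: "Q \<in> GG.C (Suc q)" and R: "R \<in> GG.C (Suc r)"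
  shows "nr p (q + r) P (nr q r Q R)
       = nr (p + q) r (nr p q P Q) R + sign_scale (p * q) (nr q (p + r) Q (nr p r P R))"
proof -
  let ?i = "insertion \<alpha>"
  have comm: "?i (a + b) (nr a b A B) E = ?i a A (?i b B E) - sign_scale (a * b) (?i b B (?i a A E))"
    if "A \<in> GG.C (Suc a)" "B \<in> GG.C (Suc b)" "E \<in> GG.C (Suc e)" for a b e A B E
    unfolding nr_def by (rule insertion_commutator[OF that])
  note lin = insertion_diff_right insertion_scale_right
    GG.maps.scale_right_diff_distrib
  have pointwise: "sign_scale k f xs = signed k (f xs)" for k f xs
    by (simp add: fun_scale_def signed_def)
  show ?thesis
    unfolding nr_def[of p "q + r"] nr_def[of "p + q" r] nr_def[of q "p + r"]
      comm[OF P Q R] comm[OF Q R P] comm[OF P R Q]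
    unfolding nr_def lin
    by (cases "even p"; cases "even q"; cases "even r")
      (auto simp: fun_eq_iff pointwise signed_def)
qed

lemma bilinear_nr_bracket:
  "bilinear_on (fun_scale sg) (GG.C m) (fun_scale sg) (GG.C n) (fun_scale sg) (cochain_sums GG.C)
     (nr_bracket sg \<alpha> m n)"
proof -
  have "nr_bracket sg \<alpha> m n = (\<lambda>P Q. contraction \<alpha> sg m n P Q
      - fun_scale sg ((-1) ^ ((m - 1) * (n - 1))) (contraction \<alpha> sg n m Q P))"
    by (simp add: nr_bracket_def fun_eq_iff)
  then show ?thesis
    using bilinear_on_diff_flip[OF bilinear_contraction[of m n] bilinear_contraction[of n m]
      GG.maps.vector_space_axioms GG.subspace_cochain_sums] by simp
qed

lemma C_shifted_eq: "C_shifted sg \<alpha> = (\<lambda>n. GG.C (Suc n))"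
  by (simp add: C_shifted_def C_unshifted_def fun_eq_iff)

lemma bilinear_extension_nr:
  assumes "P \<in> GG.C (Suc p)" "Q \<in> GG.C (Suc q)"
  shows "bilinear_extension (nr_bracket sg \<alpha>) P Q = nr p q P Q"
  unfolding nr_bracket_eq_nr[OF assms, symmetric]
  by (rule bilinear_extension_eq_if_bilinear_on[OF bilinear_nr_bracket])
    (use assms in \<open>auto intro: GG.maps.vector_space_axioms GG.maps.subspace_0[OF GG.subspace_C] GG.C_length\<close>)

lemma graded_lie_algebra_nr:
  "graded_lie_algebra (fun_scale sg) (C_shifted sg \<alpha>) (bilinear_extension (nr_bracket sg \<alpha>))"
proof -
  note A = C_shifted_eq
  interpret A: graded_vector_space "fun_scale sg" "C_shifted sg \<alpha>"
    unfolding A by (rule GG.graded_C_Suc)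
  have total: "A.total = cochain_sums GG.C"
    unfolding A.total_def unfolding A by (rule GG.span_C_Suc)
  note ext = bilinear_extension_nr
  show ?thesis
  proof unfold_locales
    show "bilinear_on (fun_scale sg) A.total (fun_scale sg) A.total (fun_scale sg) A.total
        (bilinear_extension (nr_bracket sg \<alpha>))"
      unfolding total
      by (intro bilinear_on_bilinear_extension bilinear_nr_bracket GG.subspace_cochain_sums GG.G.vector_space_axioms
          GG.maps.vector_space_axioms GG.maps.subspace_0[OF GG.subspace_C])
  next
    fix x y i j assume "x \<in> C_shifted sg \<alpha> i" "y \<in> C_shifted sg \<alpha> j"
    then have xy: "x \<in> GG.C (Suc i)" "y \<in> GG.C (Suc j)" by (auto simp: A)
    show "bilinear_extension (nr_bracket sg \<alpha>) x y \<in> C_shifted sg \<alpha> (i + j)"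
      using nr_in_C[OF xy] by (simp add: ext[OF xy] A)
    show "bilinear_extension (nr_bracket sg \<alpha>) x y
        = - fun_scale sg ((-1) ^ (i * j)) (bilinear_extension (nr_bracket sg \<alpha>) y x)"
      unfolding ext[OF xy] ext[OF xy(2,1)] by (rule nr_skew)
  next
    fix x y z i j l assume "x \<in> C_shifted sg \<alpha> i" "y \<in> C_shifted sg \<alpha> j" "z \<in> C_shifted sg \<alpha> l"
    then have xyz: "x \<in> GG.C (Suc i)" "y \<in> GG.C (Suc j)" "z \<in> GG.C (Suc l)" by (auto simp: A)
    let ?br = "bilinear_extension (nr_bracket sg \<alpha>)"
    show "?br x (?br y z) = ?br (?br x y) z + fun_scale sg ((-1) ^ (i * j)) (?br y (?br x z))"
      using nr_jacobi[OF xyz]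
      by (simp add: ext[OF xyz(1,2)] ext[OF xyz(2,3)] ext[OF xyz(1,3)] ext[OF xyz(1) nr_in_C[OF xyz(2,3)]]
          ext[OF nr_in_C[OF xyz(1,2)] xyz(3)] ext[OF xyz(2) nr_in_C[OF xyz(1,3)]])
  qed
qed

end

section \<open>The cup product bracket\<close>

text \<open>
  The exponents \<open>b\<close> and \<open>c\<close> are free parameters; in the cup product bracket they are one less than
  the arity of the opposite factor.
\<close>

definition cup :: "('h \<Rightarrow> 'h \<Rightarrow> 'h) \<Rightarrow> ('h \<Rightarrow> 'h) \<Rightarrow> nat \<Rightarrow> nat \<Rightarrow> ('g list \<Rightarrow> 'h) \<Rightarrow> ('g list \<Rightarrow> 'h)
    \<Rightarrow> 'g list \<Rightarrow> 'h::ab_group_add" where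
  "cup br \<beta> b c P Q xs = unshuffle_sum (\<lambda>ys zs. br ((\<beta> ^^ b) (P ys)) ((\<beta> ^^ c) (Q zs))) xs"

locale cup_products = cochains sg sV \<alpha> \<beta> + hom_lie_algebra sV br \<beta>
  for sg :: "'k::field_char_0 \<Rightarrow> 'g::ab_group_add \<Rightarrow> 'g" and sV :: "'k \<Rightarrow> 'v::ab_group_add \<Rightarrow> 'v"
    and \<alpha> :: "'g \<Rightarrow> 'g" and \<beta> :: "'v \<Rightarrow> 'v" and br :: "'v \<Rightarrow> 'v \<Rightarrow> 'v"
begin

lemma br_additive: "additive (br x)" "additive (\<lambda>x. br x y)"
  using additive_if_linear linear_left linear_right by blast+

lemma br_0 [simp]: "br 0 y = 0" "br x 0 = 0"
  using additive.zero[OF br_additive(1)] additive.zero[OF br_additive(2)] by blast+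

lemma \<beta>_pow_0 [simp]: "(\<beta> ^^ k) 0 = 0"
  using additive.zero[OF additive_if_linear[OF linear_\<beta>_pow]] .

lemma \<beta>_pow_br: "(\<beta> ^^ k) (br x y) = br ((\<beta> ^^ k) x) ((\<beta> ^^ k) y)"
  by (induction k) (auto simp: multiplicative)

lemma \<beta>_pow_pow: "(\<beta> ^^ k) ((\<beta> ^^ l) x) = (\<beta> ^^ (k + l)) x"
  by (simp add: funpow_add)

text \<open>
  The Hom-Jacobi identity as a twisted Leibniz rule, the form in which it enters the graded Jacobi
  identity.
\<close>

lemma hom_jacobi_derivation:
  "br (\<beta> x) (br y z) = br (br x y) (\<beta> z) + br (\<beta> y) (br x z)"
proof -
  have "br (\<beta> y) (br z x) = - br (\<beta> y) (br x z)"
    using skew[of z x] additive.minus[OF br_additive(1)] by metis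
  moreover have "br (\<beta> z) (br x y) = - br (br x y) (\<beta> z)"
    by (rule skew)
  ultimately show ?thesis
    using hom_jacobi[of x y z] by (simp add: algebra_simps)
qed

lemma cup_support:
  assumes P: "P \<in> C m" and Q: "Q \<in> C n" and "length ys \<noteq> m \<or> length zs \<noteq> n"
  shows "br ((\<beta> ^^ b) (P ys)) ((\<beta> ^^ c) (Q zs)) = 0"
  using assms(3) C_length[OF P, of ys] C_length[OF Q, of zs] by auto

lemma cup_bracket_eq_cup:
  assumes P: "P \<in> C m" and Q: "Q \<in> C n"
  shows "cup_bracket sV br \<beta> m n P Q = cup br \<beta> (n - 1) (m - 1) P Q"
proof
  fix xs
  let ?G = "\<lambda>ys zs. br ((\<beta> ^^ (n - 1)) (P ys)) ((\<beta> ^^ (m - 1)) (Q zs))"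
  note supp = cup_support[OF P Q]
  show "cup_bracket sV br \<beta> m n P Q xs = cup br \<beta> (n - 1) (m - 1) P Q xs"
  proof (cases "length xs = m + n")
    case True
    have "cup_bracket sV br \<beta> m n P Q xs = unshuffle_sum (\<lambda>ys zs. if length ys = m then ?G ys zs else 0) xs"
      unfolding sum_Sh_eq_unshuffle_sum[OF V.vector_space_axioms True, where G = ?G, symmetric]
      using True by (simp add: cup_bracket_def)
    also have "\<dots> = unshuffle_sum ?G xs"
      by (rule unshuffle_sum_cong) (simp add: supp)
    finally show ?thesis by (simp add: cup_def)
  next
    case False
    then show ?thesis
      by (auto simp: cup_bracket_def cup_def intro!: unshuffle_sum_eq_0 supp)
  qed
qed

lemma cup_in_C:
  assumes P: "P \<in> C m" and Q: "Q \<in> C n"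
  shows "cup br \<beta> b c P Q \<in> C (m + n)"
  unfolding mem_C_iff
proof (intro conjI allI impI)
  let ?G = "\<lambda>ys zs. br ((\<beta> ^^ b) (P ys)) ((\<beta> ^^ c) (Q zs))"
  show "cup br \<beta> b c P Q xs = 0" if "length xs \<noteq> m + n \<or> m + n = 0" for xs
    unfolding cup_def using that C_arity_pos[OF P] by (intro unshuffle_sum_eq_0) (auto intro: cup_support[OF P Q])
  have "Vector_Spaces.linear sg sV (\<lambda>x. ?G (us @ x # vs) zs)" for us vs zs
    using Vector_Spaces.linear_compose[OF Vector_Spaces.linear_compose[OF C_linear[OF P] linear_\<beta>_pow] linear_left]
    by (simp add: o_def)
  moreover have "Vector_Spaces.linear sg sV (\<lambda>x. ?G ys (us @ x # vs))" for us vs ys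
    using Vector_Spaces.linear_compose[OF Vector_Spaces.linear_compose[OF C_linear[OF Q] linear_\<beta>_pow] linear_right]
    by (simp add: o_def)
  ultimately show "Vector_Spaces.linear sg sV (\<lambda>x. cup br \<beta> b c P Q (us @ x # vs))" for us vs
    unfolding cup_def
    by (intro linear_slot_unshuffle_sum G.vector_space_axioms V.vector_space_axioms)
  show "cup br \<beta> b c P Q (us @ x # x # vs) = 0" for us x vs
    unfolding cup_def
    by (intro unshuffle_sum_eq_adjacent) (simp_all add: C_adjacent[OF P] C_adjacent[OF Q])
  show "\<beta> (cup br \<beta> b c P Q xs) = cup br \<beta> b c P Q (map \<alpha> xs)" for xs
    unfolding cup_def unshuffle_sum_hom[OF additive_if_linear[OF linear_\<beta>]] unshuffle_sum_map
    by (simp add: C_twist[OF Q, symmetric] C_twist[OF P, symmetric] multiplicative funpow_swap1)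
qed

lemma bilinear_cup_bracket:
  "bilinear_on (fun_scale sV) (C m) (fun_scale sV) (C n) (fun_scale sV) (cochain_sums C)
     (cup_bracket sV br \<beta> m n)"
proof -
  have "(\<beta> ^^ k) (x + y) = (\<beta> ^^ k) x + (\<beta> ^^ k) y" "(\<beta> ^^ k) (sV d x) = sV d ((\<beta> ^^ k) x)"
    "br (x + y) z = br x z + br y z" "br z (x + y) = br z x + br z y"
    "br (sV d x) z = sV d (br x z)" "br x (sV d z) = sV d (br x z)" for k x y z d
    using linear_\<beta>_pow linear_left linear_right by (auto simp: Vector_Spaces.linear_iff)
  note lin = this
  have hom: "sV d (unshuffle_sum G xs) = unshuffle_sum (\<lambda>ys zs. sV d (G ys zs)) xs" for d xs
    and G :: "'g list \<Rightarrow> 'g list \<Rightarrow> 'v"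
    by (rule unshuffle_sum_hom) (simp add: additive_def V.scale_right_distrib)
  have "cup br \<beta> b c (P + P') Q = cup br \<beta> b c P Q + cup br \<beta> b c P' Q"
    "cup br \<beta> b c P (Q + Q') = cup br \<beta> b c P Q + cup br \<beta> b c P Q'"
    "cup br \<beta> b c (fun_scale sV d P) Q = fun_scale sV d (cup br \<beta> b c P Q)"
    "cup br \<beta> b c P (fun_scale sV d Q) = fun_scale sV d (cup br \<beta> b c P Q)"
    for b c d and P P' Q Q' :: "'g list \<Rightarrow> 'v"
    by (simp_all add: cup_def fun_eq_iff fun_scale_def lin hom unshuffle_sum_add[symmetric])
  then show ?thesis
    unfolding bilinear_on_def
    using maps.subspace_add[OF subspace_C] maps.subspace_scale[OF subspace_C]
      subsetD[OF C_subset_cochain_sums cup_in_C]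
    by (auto simp: cup_bracket_eq_cup)
qed

lemma cup_skew:
  assumes P: "P \<in> C m" and Q: "Q \<in> C n"
  shows "cup br \<beta> b c P Q = - fun_scale sV ((-1) ^ (m * n)) (cup br \<beta> c b Q P)"
proof
  fix xs
  have "cup br \<beta> b c P Q xs = unshuffle_sum (\<lambda>ys zs.
      signed (length ys * length zs) (br ((\<beta> ^^ b) (P zs)) ((\<beta> ^^ c) (Q ys)))) xs"
    unfolding cup_def by (rule unshuffle_sum_cocomm)
  also have "\<dots> = unshuffle_sum (\<lambda>ys zs. signed (Suc (m * n)) (br ((\<beta> ^^ c) (Q ys)) ((\<beta> ^^ b) (P zs)))) xs"
  proof (rule unshuffle_sum_cong)
    fix ys zs
    show "signed (length ys * length zs) (br ((\<beta> ^^ b) (P zs)) ((\<beta> ^^ c) (Q ys)))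
        = signed (Suc (m * n)) (br ((\<beta> ^^ c) (Q ys)) ((\<beta> ^^ b) (P zs)))"
      using cup_support[OF P Q, of zs ys b c] skew[of "(\<beta> ^^ b) (P zs)" "(\<beta> ^^ c) (Q ys)"]
      by (cases "length zs = m \<and> length ys = n") (auto simp: mult.commute)
  qed
  also have "\<dots> = - signed (m * n) (cup br \<beta> c b Q P xs)"
    unfolding unshuffle_sum_signed cup_def by simp
  finally show "cup br \<beta> b c P Q xs = (- fun_scale sV ((-1) ^ (m * n)) (cup br \<beta> c b Q P)) xs"
    by (simp add: fun_scale_def signed_def)
qed

lemma cup_cup_right:
  "cup br \<beta> b d P (cup br \<beta> c c' Q R) xs = unshuffle_sum (\<lambda>ys ws. unshuffle_sum (\<lambda>us vs.
     br ((\<beta> ^^ b) (P ys)) (br ((\<beta> ^^ (d + c)) (Q us)) ((\<beta> ^^ (d + c')) (R vs)))) ws) xs"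
  unfolding cup_def unshuffle_sum_hom[OF additive_if_linear[OF linear_\<beta>_pow]]
    unshuffle_sum_hom[OF br_additive(1)] \<beta>_pow_br \<beta>_pow_pow ..

lemma cup_cup_left:
  "cup br \<beta> b d (cup br \<beta> c c' P Q) R xs = unshuffle_sum (\<lambda>ys ws. unshuffle_sum (\<lambda>us vs.
     br (br ((\<beta> ^^ (b + c)) (P ys)) ((\<beta> ^^ (b + c')) (Q us))) ((\<beta> ^^ d) (R vs))) ws) xs"
  unfolding cup_def unshuffle_sum_hom[OF additive_if_linear[OF linear_\<beta>_pow]]
    unshuffle_sum_hom[OF br_additive(2)] \<beta>_pow_br \<beta>_pow_pow unshuffle_sum_coassoc ..

text \<open>
  After pushing all twists inside by multiplicativity, each of the three terms is a sum over
  threefold splittings, and in each of them one more power of \<open>\<beta>\<close> is applied to the argument of the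
  outer bracket than to those of the inner one. Moving the blocks of \<open>P\<close> and \<open>Q\<close> into the same order
  produces exactly the Koszul sign, so the identity holds summand by summand.
\<close>

lemma cup_jacobi:
  assumes P: "P \<in> C (Suc i)" and Q: "Q \<in> C (Suc j)" and R: "R \<in> C (Suc l)"
  shows "cup br \<beta> (Suc (j + l)) i P (cup br \<beta> l j Q R) = cup br \<beta> l (Suc (i + j)) (cup br \<beta> j i P Q) R
    + fun_scale sV ((-1) ^ (Suc i * Suc j)) (cup br \<beta> (Suc (i + l)) j Q (cup br \<beta> l i P R))"
proof
  fix xs
  let ?p = "\<lambda>ys. (\<beta> ^^ (j + l)) (P ys)" and ?q = "\<lambda>us. (\<beta> ^^ (i + l)) (Q us)" and ?r = "\<lambda>vs. (\<beta> ^^ (i + j)) (R vs)"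
  have eq: "signed (length ys * length us) (br (\<beta> (?q us)) (br (?p ys) (?r vs)))
      = signed (Suc i * Suc j) (br (\<beta> (?q us)) (br (?p ys) (?r vs)))" for ys us vs
    using C_length[OF P, of ys] C_length[OF Q, of us]
    by (cases "length ys = Suc i \<and> length us = Suc j") auto
  have "cup br \<beta> (Suc (i + l)) j Q (cup br \<beta> l i P R) xs =
      unshuffle_sum (\<lambda>us ws. unshuffle_sum (\<lambda>ys vs. br (\<beta> (?q us)) (br (?p ys) (?r vs))) ws) xs"
    unfolding cup_cup_right by (simp add: add.commute)
  also have "\<dots> = signed (Suc i * Suc j) (unshuffle_sum (\<lambda>ys ws. unshuffle_sum (\<lambda>us vs.
      br (\<beta> (?q us)) (br (?p ys) (?r vs))) ws) xs)"
    unfolding unshuffle_sum_signed[symmetric] by (subst unshuffle_sum_swap12) (simp only: eq)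
  finally have "fun_scale sV ((-1) ^ (Suc i * Suc j)) (cup br \<beta> (Suc (i + l)) j Q (cup br \<beta> l i P R)) xs
     = unshuffle_sum (\<lambda>ys ws. unshuffle_sum (\<lambda>us vs. br (\<beta> (?q us)) (br (?p ys) (?r vs))) ws) xs"
    by (auto simp: fun_scale_def signed_def)
  moreover have "cup br \<beta> l (Suc (i + j)) (cup br \<beta> j i P Q) R xs
     = unshuffle_sum (\<lambda>ys ws. unshuffle_sum (\<lambda>us vs. br (br (?p ys) (?q us)) (\<beta> (?r vs))) ws) xs"
    unfolding cup_cup_left by (simp add: add.commute)
  moreover have "cup br \<beta> (Suc (j + l)) i P (cup br \<beta> l j Q R) xs
     = unshuffle_sum (\<lambda>ys ws. unshuffle_sum (\<lambda>us vs. br (\<beta> (?p ys)) (br (?q us) (?r vs))) ws) xs"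
    unfolding cup_cup_right by (simp add: add.commute)
  moreover have "unshuffle_sum (\<lambda>ys ws. unshuffle_sum (\<lambda>us vs. br (\<beta> (?p ys)) (br (?q us) (?r vs))) ws) xs
     = unshuffle_sum (\<lambda>ys ws. unshuffle_sum (\<lambda>us vs. br (br (?p ys) (?q us)) (\<beta> (?r vs))) ws) xs
     + unshuffle_sum (\<lambda>ys ws. unshuffle_sum (\<lambda>us vs. br (\<beta> (?q us)) (br (?p ys) (?r vs))) ws) xs"
    unfolding unshuffle_sum_add[symmetric] by (intro unshuffle_sum_cong hom_jacobi_derivation)
  ultimately show "cup br \<beta> (Suc (j + l)) i P (cup br \<beta> l j Q R) xs
    = (cup br \<beta> l (Suc (i + j)) (cup br \<beta> j i P Q) R
    + fun_scale sV ((-1) ^ (Suc i * Suc j)) (cup br \<beta> (Suc (i + l)) j Q (cup br \<beta> l i P R))) xs"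
    by (simp only: plus_fun_apply)
qed

lemma bilinear_extension_cup:
  assumes "P \<in> C m" "Q \<in> C n"
  shows "bilinear_extension (cup_bracket sV br \<beta>) P Q = cup br \<beta> (n - 1) (m - 1) P Q"
  unfolding cup_bracket_eq_cup[OF assms, symmetric]
  by (rule bilinear_extension_eq_if_bilinear_on[OF bilinear_cup_bracket])
    (use assms in \<open>auto intro: maps.vector_space_axioms maps.subspace_0[OF subspace_C] C_length\<close>)

lemma graded_lie_algebra_cup:
  "graded_lie_algebra (fun_scale sV) C (bilinear_extension (cup_bracket sV br \<beta>))"
proof -
  interpret B: graded_vector_space "fun_scale sV" C
    by (rule graded_C)
  have total: "B.total = cochain_sums C"
    unfolding B.total_def by (rule span_C)
  let ?br = "bilinear_extension (cup_bracket sV br \<beta>)"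
  note ext = bilinear_extension_cup
  have degree: "?br x y \<in> C (i + j)" if "x \<in> C i" "y \<in> C j" for x y i j
    unfolding ext[OF that] by (rule cup_in_C[OF that])
  have C_0_mem: "0 \<in> C n" for n
    using maps.subspace_0[OF subspace_C] .
  have zero: "?br x 0 = 0" "?br 0 x = 0" for x
    by (simp_all add: bilinear_extension_def)
  show ?thesis
  proof unfold_locales
    show "bilinear_on (fun_scale sV) B.total (fun_scale sV) B.total (fun_scale sV) B.total ?br"
      unfolding total
      by (intro bilinear_on_bilinear_extension bilinear_cup_bracket subspace_cochain_sums V.vector_space_axioms
          maps.vector_space_axioms C_0_mem)
  next
    fix x y i j assume xy: "x \<in> C i" "y \<in> C j"
    show "?br x y \<in> C (i + j)"
      by (rule degree[OF xy])
    show "?br x y = - fun_scale sV ((-1) ^ (i * j)) (?br y x)"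
      unfolding ext[OF xy] ext[OF xy(2,1)] by (rule cup_skew[OF xy])
  next
    fix x y z i j l assume xyz: "x \<in> C i" "y \<in> C j" "z \<in> C l"
    show "?br x (?br y z) = ?br (?br x y) z + fun_scale sV ((-1) ^ (i * j)) (?br y (?br x z))"
    \<comment> \<open>In degree \<open>0\<close> there is only the zero cochain; this case is split off because the exponents
      \<open>n - 1\<close> are truncated there.\<close>
    proof (cases "i = 0 \<or> j = 0 \<or> l = 0")
      case True
      then have "x = 0 \<or> y = 0 \<or> z = 0"
        using C_arity_pos xyz by blast
      then show ?thesis
        by (auto simp: zero)
    next
      case False
      then obtain i' j' l' where n: "i = Suc i'" "j = Suc j'" "l = Suc l'"
        by (auto simp: gr0_conv_Suc)
      have "?br x (?br y z) = cup br \<beta> (Suc (j' + l')) i' x (cup br \<beta> l' j' y z)"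
        using ext[OF xyz(1) degree[OF xyz(2,3)]] ext[OF xyz(2,3)] by (simp add: n)
      moreover have "?br (?br x y) z = cup br \<beta> l' (Suc (i' + j')) (cup br \<beta> j' i' x y) z"
        using ext[OF degree[OF xyz(1,2)] xyz(3)] ext[OF xyz(1,2)] by (simp add: n)
      moreover have "?br y (?br x z) = cup br \<beta> (Suc (i' + l')) j' y (cup br \<beta> l' i' x z)"
        using ext[OF xyz(2) degree[OF xyz(1,3)]] ext[OF xyz(1,3)] by (simp add: n)
      ultimately show ?thesis
        using cup_jacobi[of x i' y j' z l'] xyz by (simp only: n)
    qed
  qed
qed

end

section \<open>Contraction as a derivation\<close>

locale contractions_on_cup = contractions sg sV \<alpha> \<beta> + cup_products sg sV \<alpha> \<beta> br
  for sg :: "'k::field_char_0 \<Rightarrow> 'g::ab_group_add \<Rightarrow> 'g" and sV :: "'k \<Rightarrow> 'v::ab_group_add \<Rightarrow> 'v"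
    and \<alpha> :: "'g \<Rightarrow> 'g" and \<beta> :: "'v \<Rightarrow> 'v" and br :: "'v \<Rightarrow> 'v \<Rightarrow> 'v"
begin

text \<open>
  The value of \<open>P\<close>, again the first entry of the list to be split, goes to \<open>E\<close> or to \<open>F\<close>. In the
  second case the arguments of \<open>P\<close> have to be moved past those of \<open>E\<close>; with the sign \<open>e + 1\<close> for
  moving the value of \<open>P\<close> itself past them, \<open>p (e + 1)\<close> remains modulo \<open>2\<close>. The powers of the
  twists agree because \<open>E\<close> and \<open>F\<close> intertwine \<open>\<alpha>\<close> with \<open>\<beta>\<close>.
\<close>

lemma insertion_cup:
  assumes P: "P \<in> GG.C (Suc p)" and E: "E \<in> GV.C (Suc e)" and F: "F \<in> GV.C (Suc f)"
  shows "insertion \<alpha> p P (cup br \<beta> f e E F) = cup br \<beta> f (p + e) (insertion \<alpha> p P E) F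
     + fun_scale sV ((-1) ^ (p * Suc e)) (cup br \<beta> (p + f) e E (insertion \<alpha> p P F))"
proof
  fix xs
  have tw: "(\<beta> ^^ k) (E (map (\<alpha> ^^ p) us)) = (\<beta> ^^ (p + k)) (E us)"
    "(\<beta> ^^ k) (F (map (\<alpha> ^^ p) us)) = (\<beta> ^^ (p + k)) (F us)" for k us
    unfolding GV.C_twist_pow[OF E, symmetric] GV.C_twist_pow[OF F, symmetric] \<beta>_pow_pow
    by (simp_all add: add.commute)
  have "insertion \<alpha> p P (cup br \<beta> f e E F) xs =
      unshuffle_sum (\<lambda>ys ws. unshuffle_sum (\<lambda>us vs.
        br ((\<beta> ^^ f) (E (P ys # map (\<alpha> ^^ p) us))) ((\<beta> ^^ (p + e)) (F vs))) ws
      + unshuffle_sum (\<lambda>us vs. signed (length us)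
          (br ((\<beta> ^^ (p + f)) (E us)) ((\<beta> ^^ e) (F (P ys # map (\<alpha> ^^ p) vs))))) ws) xs"
    unfolding insertion_def cup_def unshuffle_sum.simps unshuffle_sum_map list.map length_map tw ..
  also have "\<dots> = unshuffle_sum (\<lambda>ys ws. unshuffle_sum (\<lambda>us vs.
        br ((\<beta> ^^ f) (E (P ys # map (\<alpha> ^^ p) us))) ((\<beta> ^^ (p + e)) (F vs))) ws) xs
      + unshuffle_sum (\<lambda>ys ws. unshuffle_sum (\<lambda>us vs. signed (length us)
          (br ((\<beta> ^^ (p + f)) (E us)) ((\<beta> ^^ e) (F (P ys # map (\<alpha> ^^ p) vs))))) ws) xs"
    by (rule unshuffle_sum_add)
  also have "unshuffle_sum (\<lambda>ys ws. unshuffle_sum (\<lambda>us vs.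
        br ((\<beta> ^^ f) (E (P ys # map (\<alpha> ^^ p) us))) ((\<beta> ^^ (p + e)) (F vs))) ws) xs
      = cup br \<beta> f (p + e) (insertion \<alpha> p P E) F xs"
    unfolding cup_def insertion_def unshuffle_sum_hom[OF additive_if_linear[OF GV.linear_\<beta>_pow]]
      unshuffle_sum_hom[OF br_additive(2)] unshuffle_sum_coassoc ..
  also have "unshuffle_sum (\<lambda>ys ws. unshuffle_sum (\<lambda>us vs. signed (length us)
          (br ((\<beta> ^^ (p + f)) (E us)) ((\<beta> ^^ e) (F (P ys # map (\<alpha> ^^ p) vs))))) ws) xs
      = unshuffle_sum (\<lambda>us ws. unshuffle_sum (\<lambda>ys vs. signed (p * Suc e)
          (br ((\<beta> ^^ (p + f)) (E us)) ((\<beta> ^^ e) (F (P ys # map (\<alpha> ^^ p) vs))))) ws) xs"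
  proof -
    have "signed (length us * length ys + length us)
          (br ((\<beta> ^^ (p + f)) (E us)) ((\<beta> ^^ e) (F (P ys # map (\<alpha> ^^ p) vs))))
      = signed (p * Suc e) (br ((\<beta> ^^ (p + f)) (E us)) ((\<beta> ^^ e) (F (P ys # map (\<alpha> ^^ p) vs))))" for us ys vs
    proof (cases "length us = Suc e \<and> length ys = Suc p")
      case False
      then have "E us = 0 \<or> P ys = 0"
        using GV.C_length[OF E] GG.C_length[OF P] by blast
      then show ?thesis
        using GV.C_0[OF F] by auto
    qed (auto intro!: signed_cong_parity)
    then show ?thesis
      by (subst unshuffle_sum_swap12) simp
  qed
  also have "\<dots> = signed (p * Suc e) (cup br \<beta> (p + f) e E (insertion \<alpha> p P F) xs)"
    unfolding cup_def insertion_def unshuffle_sum_hom[OF additive_if_linear[OF GV.linear_\<beta>_pow]]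
      unshuffle_sum_hom[OF br_additive(1)] unshuffle_sum_signed ..
  finally show "insertion \<alpha> p P (cup br \<beta> f e E F) xs = (cup br \<beta> f (p + e) (insertion \<alpha> p P E) F
     + fun_scale sV ((-1) ^ (p * Suc e)) (cup br \<beta> (p + f) e E (insertion \<alpha> p P F))) xs"
    by (simp add: fun_scale_def signed_def)
qed

end

section \<open>The action\<close>

theorem proposition4p2:
  fixes scale_g :: "'k::field_char_0 \<Rightarrow> 'g::ab_group_add \<Rightarrow> 'g"
    and br_g :: "'g \<Rightarrow> 'g \<Rightarrow> 'g" and \<alpha> :: "'g \<Rightarrow> 'g"
    and scale_h :: "'k \<Rightarrow> 'h::ab_group_add \<Rightarrow> 'h"
    and br_h :: "'h \<Rightarrow> 'h \<Rightarrow> 'h" and \<beta> :: "'h \<Rightarrow> 'h"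
  assumes "hom_lie_algebra scale_g br_g \<alpha>" and "hom_lie_algebra scale_h br_h \<beta>"
  shows "graded_lie_action
           (fun_scale scale_g) (C_shifted scale_g \<alpha>) (bilinear_extension (nr_bracket scale_g \<alpha>))
           (fun_scale scale_h) (C_unshifted scale_g \<alpha> scale_h \<beta>)
             (bilinear_extension (cup_bracket scale_h br_h \<beta>))
           (bilinear_extension (contraction \<alpha> scale_h))"
proof -
  interpret g: hom_lie_algebra scale_g br_g \<alpha> by fact
  interpret h: hom_lie_algebra scale_h br_h \<beta> by fact
  have cochains_g: "cochains scale_g scale_g \<alpha> \<alpha>"
    and cochains_h: "cochains scale_g scale_h \<alpha> \<beta>"
    by (intro cochains.intro cochains_axioms.intro g.vector_space_axioms h.vector_space_axioms
        g.linear_twist h.linear_twist)+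
  interpret gg: nr_bracket_algebra scale_g \<alpha>
    by (intro nr_bracket_algebra.intro contractions.intro cochains_g)
  interpret gh: contractions_on_cup scale_g scale_h \<alpha> \<beta> br_h
    by (intro contractions_on_cup.intro contractions.intro cup_products.intro
        cochains_g cochains_h assms)
  interpret A: graded_lie_algebra "fun_scale scale_g" "C_shifted scale_g \<alpha>" "bilinear_extension (nr_bracket scale_g \<alpha>)"
    by (rule gg.graded_lie_algebra_nr)
  interpret B: graded_lie_algebra "fun_scale scale_h" gh.GV.C "bilinear_extension (cup_bracket scale_h br_h \<beta>)"
    by (rule gh.graded_lie_algebra_cup)
  note A = gg.C_shifted_eq
  let ?cup = "bilinear_extension (cup_bracket scale_h br_h \<beta>)"
    and ?nr = "bilinear_extension (nr_bracket scale_g \<alpha>)"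
    and ?i = "bilinear_extension (contraction \<alpha> scale_h)"
  have totalA: "A.total = cochain_sums gg.GG.C"
    unfolding A.total_def unfolding A by (rule gg.GG.span_C_Suc)
  have totalB: "B.total = cochain_sums gh.GV.C"
    unfolding B.total_def by (rule gh.GV.span_C)
  note zeros = gg.GG.maps.subspace_0[OF gg.GG.subspace_C] gh.GV.maps.subspace_0[OF gh.GV.subspace_C]
    and spaces = gg.GG.maps.vector_space_axioms gh.GV.maps.vector_space_axioms
  have i: "?i P E = insertion \<alpha> p P E" if "P \<in> gg.GG.C (Suc p)" "E \<in> gh.GV.C e" for P E p e
  proof -
    have "?i P E = contraction \<alpha> scale_h (Suc p) e P E"
      by (rule bilinear_extension_eq_if_bilinear_on[OF gh.bilinear_contraction])
        (use that in \<open>auto intro: zeros spaces gg.GG.C_length gh.GV.C_length\<close>)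
    then show ?thesis
      using gh.contraction_eq_insertion[OF that] by simp
  qed
  have zero: "?i P 0 = 0" "?cup E 0 = 0" "?cup 0 E = 0" for P E
    by (simp_all add: bilinear_extension_def)
  have degree: "?i P E \<in> gh.GV.C (p + e)" if "P \<in> gg.GG.C (Suc p)" "E \<in> gh.GV.C e" for P E p e
    unfolding i[OF that] by (rule gh.insertion_in_C[OF that])
  show ?thesis
  proof unfold_locales
    show "bilinear_on (fun_scale scale_g) A.total (fun_scale scale_h) B.total (fun_scale scale_h) B.total ?i"
      unfolding totalA totalB
      by (intro bilinear_on_bilinear_extension gh.bilinear_contraction gh.GV.subspace_cochain_sums
          g.vector_space_axioms h.vector_space_axioms spaces zeros)
  next
    fix P E m e assume "P \<in> C_shifted scale_g \<alpha> m" "E \<in> gh.GV.C e"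
    then show "?i P E \<in> gh.GV.C (m + e)"
      using degree by (simp add: A)
  next
    fix P Q E p q e assume "P \<in> C_shifted scale_g \<alpha> p" "Q \<in> C_shifted scale_g \<alpha> q" and E: "E \<in> gh.GV.C e"
    then have P: "P \<in> gg.GG.C (Suc p)" and Q: "Q \<in> gg.GG.C (Suc q)"
      by (auto simp: A)
    have "?i (?nr P Q) E = insertion \<alpha> (p + q) (gg.nr p q P Q) E"
      using i[OF gg.nr_in_C[OF P Q] E] gg.bilinear_extension_nr[OF P Q] by simp
    then show "?i (?nr P Q) E = ?i P (?i Q E) - fun_scale scale_h ((-1) ^ (p * q)) (?i Q (?i P E))"
      using gh.insertion_commutator[OF P Q E] i[OF P degree[OF Q E]] i[OF Q degree[OF P E]] i[OF P E] i[OF Q E]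
      by (simp add: gg.nr_def)
  next
    fix P E F p e f
    assume "P \<in> C_shifted scale_g \<alpha> p" and E: "E \<in> gh.GV.C e" and F: "F \<in> gh.GV.C f"
    then have P: "P \<in> gg.GG.C (Suc p)"
      by (auto simp: A)
    show "?i P (?cup E F) = ?cup (?i P E) F + fun_scale scale_h ((-1) ^ (p * e)) (?cup E (?i P F))"
    proof (cases "e = 0 \<or> f = 0")
      case True
      then have "E = 0 \<or> F = 0"
        using gh.GV.C_arity_pos E F by blast
      then show ?thesis
        by (auto simp: zero)
    next
      case False
      then obtain e' f' where n: "e = Suc e'" "f = Suc f'"
        by (auto simp: gr0_conv_Suc)
      have "?i P (?cup E F) = insertion \<alpha> p P (cup br_h \<beta> f' e' E F)"
        using i[OF P gh.cup_in_C[OF E F]] gh.bilinear_extension_cup[OF E F] by (simp add: n)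
      moreover have "?cup (?i P E) F = cup br_h \<beta> f' (p + e') (insertion \<alpha> p P E) F"
        using gh.bilinear_extension_cup[OF degree[OF P E] F] i[OF P E] by (simp add: n)
      moreover have "?cup E (?i P F) = cup br_h \<beta> (p + f') e' E (insertion \<alpha> p P F)"
        using gh.bilinear_extension_cup[OF E degree[OF P F]] i[OF P F] by (simp add: n)
      ultimately show ?thesis
        using gh.insertion_cup[of P p E e' F f'] P E F by (simp only: n)
    qed
  qed
qed

end
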